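(* Let $p$ be a prime and let $\mathbf w=(w_0,\dots,w_n)$ be a vector of positive integers with $\gcd(w_0,\dots,w_n)=1$. If some integer $e\ge2$ prime to $p$ divides one of the weights $w_i$, then for every power $q$ of $p$ the twist zeta function $Z_{\mathrm{tw}}(\mathcal P_{\mathbf w},t)$ over $\mathbb F_q$ admits no single global functional equation under $t\mapsto1/(q^nt)$. Moreover its multiplicity spectrum $(b_0,\dots,b_n)$, and with it the failure of palindromy, is the same for every power $q$ of $p$: the orders of $q$ modulo the integers $e$ redistribute the reciprocal poles $\zeta q^j$ around the circles $|\alpha|=q^j$ but never between them.
   Context: For $q$ a power of $p$ and $r\ge1$, $A_{\mathbf w}(q^r)$ is the number of orbits of $\mathbb F_{q^r}^\times$ on $\mathbb F_{q^r}^{n+1}\setminus\{0\}$ under $\lambda\cdot(x_0,\dots,x_n)=(\lambda^{w_0}x_0,\dots,\lambda^{w_n}x_n)$, and $Z_{\mathrm{tw}}(\mathcal P_{\mathbf w},t)=\exp\bigl(\sum_{r\ge1}A_{\mathbf w}(q^r)\,t^r/r\bigr)$. This is a rational function which can be written uniquely as a finite product $\prod_\alpha(1-\alpha t)^{-b(\alpha)}$ over distinct complex numbers $\alpha=\zeta q^j$ with $\zeta$ a root of unity and $0\le j\le n$, with $b(\alpha)\in\mathbb Z$. The multiplicity spectrum is $(b_0,\dots,b_n)$ with $b_j=\sum_{|\alpha|=q^j}b(\alpha)$; it is palindromic if $b_j=b_{n-j}$ for all $j$. A single global functional equation means an identity $Z_{\mathrm{tw}}(\mathcal P_{\mathbf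 w},1/(q^nt))=C\,t^{s}\,Z_{\mathrm{tw}}(\mathcal P_{\mathbf w},t)^{\pm1}$ for some nonzero constant $C$, some integer $s$ and some choice of sign. *)

theory Defs
  imports
    "HOL-Algebra.Group_Action"
    "HOL-Algebra.Multiplicative_Group"
    "HOL-Number_Theory.Number_Theory"
    "HOL-Computational_Algebra.Computational_Algebra"
    Complex_Main
begin

text \<open>A weight vector $(w_0,\dots,w_n)$ is a function on \<open>nat\<close> of which only the
  values at \<open>0, \<dots>, n\<close> matter; vectors of length $n+1$ are extensional functions on \<open>{..n}\<close>.\<close>

definition nonzero_vectors :: "('a, 'b) ring_scheme \<Rightarrow> nat \<Rightarrow> (nat \<Rightarrow> 'a) set" where
  "nonzero_vectors R n = ({..n} \<rightarrow>\<^sub>E carrier R) - {\<lambda>i\<in>{..n}. \<zero>\<^bsub>R\<^esub>}"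

text \<open>The outer restriction makes this a \<open>group_action\<close> of \<open>mult_of R\<close> in the sense of the
  library, which demands extensional bijections.\<close>

definition weighted_action ::
    "('a, 'b) ring_scheme \<Rightarrow> nat \<Rightarrow> (nat \<Rightarrow> nat) \<Rightarrow> 'a \<Rightarrow> (nat \<Rightarrow> 'a) \<Rightarrow> (nat \<Rightarrow> 'a)" where
  "weighted_action R n w c =
     (\<lambda>x\<in>nonzero_vectors R n. \<lambda>i\<in>{..n}. (c [^]\<^bsub>R\<^esub> w i) \<otimes>\<^bsub>R\<^esub> x i)"

definition num_weighted_orbits :: "('a, 'b) ring_scheme \<Rightarrow> nat \<Rightarrow> (nat \<Rightarrow> nat) \<Rightarrow> nat" where
  "num_weighted_orbits R n w =
     card (orbits (mult_of R) (nonzero_vectors R n) (weighted_action R n w))"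

text \<open>The field with \<open>Q\<close> elements is unique up to isomorphism and, being finite, has a copy
  whose carrier is a set of natural numbers. The value is junk unless \<open>Q\<close> is a prime power.\<close>

definition finite_field :: "nat \<Rightarrow> nat ring" where
  "finite_field Q = (SOME R. field R \<and> card (carrier R) = Q)"

definition twist_count :: "nat \<Rightarrow> (nat \<Rightarrow> nat) \<Rightarrow> nat \<Rightarrow> nat" where
  "twist_count n w Q = num_weighted_orbits (finite_field Q) n w"

definition twist_zeta :: "nat \<Rightarrow> (nat \<Rightarrow> nat) \<Rightarrow> nat \<Rightarrow> complex fps" where
  "twist_zeta n w q =
     fps_exp 1 oo Abs_fps (\<lambda>r. if r = 0 then 0 else of_nat (twist_count n w (q ^ r)) / of_nat r)"

definition root_of_unity :: "complex \<Rightarrow> bool" where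
  "root_of_unity \<zeta> \<longleftrightarrow> (\<exists>m>0. \<zeta> ^ m = 1)"

text \<open>\<open>F\<close> is the finite product of the factors $(1-\alpha t)^{-b(\alpha)}$, where \<open>b\<close> vanishes
  outside a finite set of numbers $\zeta q^j$ with $\zeta$ a root of unity and $0\le j\le n$.\<close>

definition cyclotomic_factorization ::
    "nat \<Rightarrow> nat \<Rightarrow> complex fps \<Rightarrow> (complex \<Rightarrow> int) \<Rightarrow> bool" where
  "cyclotomic_factorization n q F b \<longleftrightarrow>
     finite {\<alpha>. b \<alpha> \<noteq> 0} \<and>
     (\<forall>\<alpha>. b \<alpha> \<noteq> 0 \<longrightarrow> (\<exists>\<zeta> j. root_of_unity \<zeta> \<and> j \<le> n \<and> \<alpha> = \<zeta> * of_nat q ^ j)) \<and>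
     F = (\<Prod>\<alpha> | b \<alpha> \<noteq> 0. (1 - fps_const \<alpha> * fps_X) powi (- b \<alpha>))"

definition twist_multiplicity :: "nat \<Rightarrow> (nat \<Rightarrow> nat) \<Rightarrow> nat \<Rightarrow> complex \<Rightarrow> int" where
  "twist_multiplicity n w q = (THE b. cyclotomic_factorization n q (twist_zeta n w q) b)"

definition multiplicity_spectrum :: "nat \<Rightarrow> (nat \<Rightarrow> nat) \<Rightarrow> nat \<Rightarrow> nat \<Rightarrow> int" where
  "multiplicity_spectrum n w q j =
     (\<Sum>\<alpha> | twist_multiplicity n w q \<alpha> \<noteq> 0 \<and> norm \<alpha> = of_nat q ^ j. twist_multiplicity n w q \<alpha>)"

definition palindromic :: "nat \<Rightarrow> (nat \<Rightarrow> int) \<Rightarrow> bool" where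
  "palindromic n b \<longleftrightarrow> (\<forall>j\<le>n. b j = b (n - j))"

text \<open>\<open>P / Q\<close> is the rational function with power series expansion \<open>F\<close>. An identity between
  rational functions over the complex numbers is the same as equality of their values at all but
  finitely many points; leaving out finitely many points also disposes of the zeros and poles, where
  division by zero would give wrong values. The condition does not depend on the choice of \<open>P\<close>
  and \<open>Q\<close>.\<close>

definition global_functional_equation :: "nat \<Rightarrow> nat \<Rightarrow> complex fps \<Rightarrow> bool" where
  "global_functional_equation n q F \<longleftrightarrow>
     (\<exists>P Q. Q \<noteq> 0 \<and> F * fps_of_poly Q = fps_of_poly P \<and>
       (let Z = (\<lambda>t. poly P t / poly Q t) in
        \<exists>C (s::int) (\<epsilon>::int). C \<noteq> 0 \<and> \<epsilon> \<in> {1, -1} \<and>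
          (\<forall>\<^sub>\<infinity>t. Z (1 / (of_nat q ^ n * t)) = C * t powi s * Z t powi \<epsilon>)))"

end

theory Submission
  imports "HOL-Algebra.Algebraic_Closure" Defs
begin

text \<open>Let \<open>c(d)\<close> be the number of weights divisible by \<open>d\<close>. Since an element of order \<open>d\<close> of
  $\mathbb F_Q^\times$ fixes $Q^{c(d)}-1$ nonzero vectors, Burnside's lemma gives
  $A_{\mathbf w}(Q)=\sum_{d\mid Q-1}\varphi(d)\sum_{j<c(d)}Q^j$. Now \<open>d\<close> divides $q^r-1$ iff \<open>d\<close> is
  prime to \<open>p\<close> and the order $o_d$ of \<open>q\<close> modulo \<open>d\<close> divides \<open>r\<close>, and the latter condition is
  detected by the sum of the \<open>r\<close>-th powers of the $o_d$-th roots of unity. So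
  $A_{\mathbf w}(q^r)=\sum_\alpha b(\alpha)\alpha^r$, where $b(\zeta q^j)$ is the sum of
  $\varphi(d)/o_d$ over the \<open>d\<close> prime to \<open>p\<close> with \<open>c(d) > j\<close> and $\zeta^{o_d}=1$. Comparing logarithmic
  derivatives, this says that \<open>b\<close> is the multiplicity function of the zeta function; it is
  the only one because power sums determine a finitely supported function. The sum of \<open>b\<close> over a
  circle is a sum of $\varphi(d)$ and does not involve \<open>q\<close>. As all $b(\alpha)\ge 0$, the zeta function is
  \<open>1 / D\<close> for a polynomial \<open>D\<close>, which vanishes to order $b(1)\ge 2$ at \<open>1\<close> but only to order
  $b(q^n)=1$ at $q^{-n}$; either sign in a functional equation is refuted by letting
  $t\to 1$.\<close>

hide_const (open) Ring_Divisibility.mult_of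

section \<open>Finite fields of prime power order\<close>

lemma (in cring) add_pow_choose_Suc:
  assumes "x \<in> carrier R" "y \<in> carrier R" "k \<le> n"
  shows "[(Suc n choose Suc k)] \<cdot> (x [^] Suc k \<otimes> y [^] (Suc n - Suc k)) =
     x \<otimes> ([(n choose k)] \<cdot> (x [^] k \<otimes> y [^] (n - k))) \<oplus>
     y \<otimes> ([(n choose Suc k)] \<cdot> (x [^] Suc k \<otimes> y [^] (n - Suc k)))"
proof -
  \<comment> \<open>Here \<open>n - k\<close> is \<open>Suc (n - Suc k)\<close> except for
    \<open>k = n\<close>, where subtraction truncates but the coefficient
    \<open>n choose Suc n\<close> is 0.\<close>
  have *: "[(n choose Suc k)] \<cdot> (x [^] Suc k \<otimes> y [^] (n - k)) =
        y \<otimes> ([(n choose Suc k)] \<cdot> (x [^] Suc k \<otimes> y [^] (n - Suc k)))"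
  proof (cases "k = n")
    case True
    then show ?thesis
      using assms by (simp add: binomial_eq_0)
  next
    case False
    then have "n - k = Suc (n - Suc k)"
      using assms by simp
    then have "y [^] (n - k) = y \<otimes> y [^] (n - Suc k)"
      using assms by (simp add: m_comm)
    then show ?thesis
      using assms by (simp add: add_pow_rdistr m_lcomm del: nat_pow_Suc)
  qed
  have "x \<otimes> ([(n choose k)] \<cdot> (x [^] k \<otimes> y [^] (n - k))) =
      [(n choose k)] \<cdot> (x [^] Suc k \<otimes> y [^] (n - k))"
    using assms by (simp add: add_pow_rdistr m_ac)
  with * show ?thesis
    using assms by (simp add: add.nat_pow_mult[symmetric] del: nat_pow_Suc)
qed

text \<open>Induction by Pascal's rule, with the term k = 0 split off before the index is
  shifted.\<close>

lemma (in cring) binomial: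
  assumes "x \<in> carrier R" "y \<in> carrier R"
  shows "(x \<oplus> y) [^] n = (\<Oplus>k\<in>{..n}. [(n choose k)] \<cdot> (x [^] k \<otimes> y [^] (n - k)))"
proof (induction n)
  case 0
  then show ?case using assms by simp
next
  case (Suc n)
  define t where "t n k = [(n choose k)] \<cdot> (x [^] k \<otimes> y [^] (n - k))" for n k
  have t: "t n k \<in> carrier R" for n k
    using assms by (simp add: t_def)
  have step: "t (Suc n) (Suc k) = x \<otimes> t n k \<oplus> y \<otimes> t n (Suc k)" if "k \<le> n" for k
    unfolding t_def using add_pow_choose_Suc[OF assms that] .
  have "(\<Oplus>k\<in>{..Suc n}. t (Suc n) k) = (\<Oplus>k\<in>{..n}. t (Suc n) (Suc k)) \<oplus> t (Suc n) 0"
    using t by (intro finsum_Suc2) auto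
  also have "t (Suc n) 0 = y \<otimes> t n 0"
    using assms by (simp add: t_def m_comm)
  also have "(\<Oplus>k\<in>{..n}. t (Suc n) (Suc k)) = (\<Oplus>k\<in>{..n}. x \<otimes> t n k \<oplus> y \<otimes> t n (Suc k))"
    using t assms step by (intro finsum_cong') auto
  also have "\<dots> = (\<Oplus>k\<in>{..n}. x \<otimes> t n k) \<oplus> (\<Oplus>k\<in>{..n}. y \<otimes> t n (Suc k))"
    using t assms by (intro finsum_addf) auto
  also have "\<dots> \<oplus> y \<otimes> t n 0 =
      (\<Oplus>k\<in>{..n}. x \<otimes> t n k) \<oplus> ((\<Oplus>k\<in>{..n}. y \<otimes> t n (Suc k)) \<oplus> y \<otimes> t n 0)"
    using t assms by (intro a_assoc finsum_closed) auto
  \<comment> \<open>Reattaching the term k = 0 gives a sum up to \<open>Suc n\<close>, whose last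
    term vanishes because \<open>n choose Suc n\<close> is 0.\<close>
  also have "(\<Oplus>k\<in>{..n}. y \<otimes> t n (Suc k)) \<oplus> y \<otimes> t n 0 = (\<Oplus>k\<in>{..Suc n}. y \<otimes> t n k)"
    using t assms by (intro finsum_Suc2[symmetric]) auto
  also have "\<dots> = y \<otimes> t n (Suc n) \<oplus> (\<Oplus>k\<in>{..n}. y \<otimes> t n k)"
    using t assms by (intro finsum_Suc) auto
  also have "y \<otimes> t n (Suc n) = \<zero>"
    using assms by (simp add: t_def binomial_eq_0)
  also have "\<zero> \<oplus> (\<Oplus>k\<in>{..n}. y \<otimes> t n k) = (\<Oplus>k\<in>{..n}. y \<otimes> t n k)"
    using t assms by (intro l_zero finsum_closed) auto
  also have "(\<Oplus>k\<in>{..n}. x \<otimes> t n k) = x \<otimes> (\<Oplus>k\<in>{..n}. t n k)"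
    using t assms by (intro finsum_rdistr[symmetric]) auto
  also have "(\<Oplus>k\<in>{..n}. y \<otimes> t n k) = y \<otimes> (\<Oplus>k\<in>{..n}. t n k)"
    using t assms by (intro finsum_rdistr[symmetric]) auto
  also have "x \<otimes> (\<Oplus>k\<in>{..n}. t n k) \<oplus> y \<otimes> (\<Oplus>k\<in>{..n}. t n k) = (\<Oplus>k\<in>{..n}. t n k) \<otimes> (x \<oplus> y)"
    using t assms by (simp add: l_distr m_comm)
  also have "(\<Oplus>k\<in>{..n}. t n k) = (x \<oplus> y) [^] n"
    using Suc.IH by (simp add: t_def)
  finally show ?case
    by (simp add: t_def)
qed

lemma (in cring) add_pow_multiple_zero:
  assumes "[(p::nat)] \<cdot> \<one> = \<zero>" "p dvd m" "x \<in> carrier R"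
  shows "[(m::nat)] \<cdot> x = \<zero>"
proof -
  obtain l where l: "m = p * l" using assms by auto
  have "[m] \<cdot> x = ([m] \<cdot> \<one>) \<otimes> x"
    using assms by (simp add: add_pow_ldistr)
  also have "[m] \<cdot> \<one> = [l] \<cdot> ([p] \<cdot> \<one>)"
    using add.nat_pow_pow[of \<one> l p] by (simp add: l)
  finally show ?thesis
    using assms by simp
qed

text \<open>The inner binomial coefficients are multiples of p, so only the two extreme terms
  survive.\<close>

lemma (in cring) frobenius_prime:
  assumes "prime (p::nat)" "[p] \<cdot> \<one> = \<zero>" "x \<in> carrier R" "y \<in> carrier R"
  shows "(x \<oplus> y) [^] p = x [^] p \<oplus> y [^] p"
proof -
  obtain m where m: "p = Suc m"
    using assms(1) by (metis not0_implies_Suc not_prime_0)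
  define t where "t k = [(p choose k)] \<cdot> (x [^] k \<otimes> y [^] (p - k))" for k
  have t: "t k \<in> carrier R" for k
    using assms by (simp add: t_def)
  have zero: "t k = \<zero>" if "0 < k" "k < p" for k
  proof -
    have "p dvd (p choose k)"
      using assms(1) that by (intro dvd_choose_prime) auto
    then show ?thesis
      unfolding t_def
      by (rule add_pow_multiple_zero[OF assms(2)]) (simp_all add: assms)
  qed
  have "(x \<oplus> y) [^] p = (\<Oplus>k\<in>{..p}. t k)"
    unfolding t_def using binomial assms by simp
  also have "\<dots> = (\<Oplus>k\<in>{0, p}. t k)"
  proof (rule add.finprod_mono_neutral_cong_right)
    show "t k = \<zero>" if "k \<in> {..p} - {0, p}" for k
      using that by (intro zero) auto
  qed (use t in auto)
  also have "\<dots> = t 0 \<oplus> t p"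
    using t m by (subst finsum_insert) auto
  also have "\<dots> = x [^] p \<oplus> y [^] p"
    using assms by (simp add: t_def a_comm)
  finally show ?thesis .
qed

lemma (in cring) frobenius:
  assumes "prime (p::nat)" "[p] \<cdot> \<one> = \<zero>" "x \<in> carrier R" "y \<in> carrier R"
  shows "(x \<oplus> y) [^] (p ^ k :: nat) = x [^] (p ^ k) \<oplus> y [^] (p ^ k)"
proof (induction k)
  case 0
  then show ?case using assms by simp
next
  case (Suc k)
  have "(x \<oplus> y) [^] (p ^ Suc k) = (x [^] (p ^ k) \<oplus> y [^] (p ^ k)) [^] p"
    using assms Suc by (simp add: nat_pow_pow[symmetric] mult.commute[of p])
  also have "\<dots> = x [^] (p ^ Suc k) \<oplus> y [^] (p ^ Suc k)"
    using assms by (simp add: frobenius_prime nat_pow_pow mult.commute[of p])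
  finally show ?case .
qed

text \<open>Additivity applied to -x + x = 0 settles the sign for all p at once, without separating
  p = 2.\<close>

lemma (in cring) frobenius_uminus:
  assumes "prime (p::nat)" "[p] \<cdot> \<one> = \<zero>" "x \<in> carrier R"
  shows "(\<ominus> x) [^] (p ^ k :: nat) = \<ominus> (x [^] (p ^ k))"
proof -
  have "(\<ominus> x) [^] (p ^ k) \<oplus> x [^] (p ^ k :: nat) = \<zero> [^] (p ^ k)"
    using assms frobenius[of p "\<ominus> x" x k] by (simp add: l_neg)
  also have "\<dots> = \<zero>"
    using assms by (metis nat_pow_zero not_prime_0 power_eq_0_iff)
  finally show ?thesis
    using assms by (simp add: minus_equality)
qed

text \<open>Fixed points of a ring endomorphism are closed under the ring operations. They will form
  the field with p^k elements.\<close>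

lemma (in field) subfield_frobenius_fixed:
  assumes "prime (p::nat)" "[p] \<cdot> \<one> = \<zero>"
  shows "subfield {x \<in> carrier R. x [^] (p ^ k :: nat) = x} R"
proof (rule subfieldI')
  show "subring {x \<in> carrier R. x [^] (p ^ k :: nat) = x} R"
    using assms by (intro subringI) (auto simp: frobenius frobenius_uminus nat_pow_distrib)
  fix x assume "x \<in> {x \<in> carrier R. x [^] (p ^ k) = x} - {\<zero>}"
  then have x: "x \<in> Units R" "x \<in> carrier R" "x [^] (p ^ k) = x"
    by (auto simp: field_Units)
  \<comment> \<open>Since x equals its own power, the same power of \<open>inv x\<close> is again an
    inverse of x.\<close>
  have "x \<otimes> (inv x) [^] (p ^ k) = (x \<otimes> inv x) [^] (p ^ k)"
    using x by (simp add: nat_pow_distrib del: Units_r_inv)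
  then have "inv x = (inv x) [^] (p ^ k)"
    using x by (intro comm_inv_char) auto
  then show "inv x \<in> {x \<in> carrier R. x [^] (p ^ k) = x}"
    using x by simp
qed

lemma (in ring_hom_ring) hom_add_pow_nat:
  assumes "x \<in> carrier R"
  shows "h (add_pow R (n::nat) x) = add_pow S n (h x)"
  using assms by (induction n) (simp_all)

text \<open>The fixed points are the roots of X^q - X, which splits, so there are q of them once the
  roots are known to be simple. Simplicity comes from Frobenius: at a root a the polynomial equals
  (X - a)^q - (X - a), whose cofactor (X - a)^(q-1) - 1 takes the value -1 at a.\<close>

lemma (in algebraically_closed) card_frobenius_fixed:
  fixes p :: nat
  assumes p: "prime p" and char: "[p] \<cdot> \<one> = \<zero>" and "k \<ge> 1"
  shows "card {x \<in> carrier L. x [^] (p ^ k) = x} = p ^ k"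
proof -
  let ?UP = "poly_ring L"
  define q where "q = p ^ k"
  have q: "q > 1"
    unfolding q_def using p assms(3) by (metis one_less_power prime_gt_1_nat not_one_le_zero neq0_conv)
  interpret UP: domain ?UP
    by (rule univ_poly_is_domain[OF carrier_is_subring])
  interpret const: ring_hom_ring L ?UP poly_of_const
    using canonical_embedding_ring_hom[OF carrier_is_subring] by simp
  have X: "X \<in> carrier ?UP"
    by (rule var_closed(1)[OF carrier_is_subring])
  define P where "P = X [^]\<^bsub>?UP\<^esub> q \<ominus>\<^bsub>?UP\<^esub> X"
  have P: "P \<in> carrier ?UP"
    using X by (simp add: P_def)
  have deg_X: "length (\<ominus>\<^bsub>?UP\<^esub> X) - 1 = 1"
    using univ_poly_a_inv_degree[OF carrier_is_subring X] by (simp add: var_def)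
  have deg_Xq: "length (X [^]\<^bsub>?UP\<^esub> q) - 1 = q"
    using unitary_monom_eq_var_pow[OF carrier_is_subring, of q, symmetric]
    by (simp add: monom_def)
  have "length P - 1 = q"
    unfolding P_def a_minus_def univ_poly_add
    by (subst poly_add_degree_eq[OF carrier_is_subring])
      (use X deg_X deg_Xq q in \<open>auto simp: univ_poly_carrier\<close>)
  then have size: "size (roots P) = q"
    using roots_over_carrier[OF P] by (simp add: splitted_def)
  have eval_P: "eval P a = a [^] q \<ominus> a" if "a \<in> carrier L" for a
  proof -
    interpret ev: ring_hom_ring ?UP L "\<lambda>p. eval p a"
      by (rule eval_ring_hom[OF carrier_is_subring that])
    show ?thesis
      using X that ev.hom_nat_pow[OF X, of q] unfolding P_def a_minus_def by (simp add: eval_var)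
  qed
  have "P \<noteq> []"
    using \<open>length P - 1 = q\<close> q by auto
  then have root_iff: "a \<in># roots P \<longleftrightarrow> a \<in> carrier L \<and> a [^] q = a" for a
    using roots_mem_iff_is_root[OF P, of a] eval_P[of a]
    by (metis (no_types, lifting) is_root_def nat_pow_closed r_right_minus_eq)
  \<comment> \<open>The constants embed the field into the polynomial ring, so Frobenius is additive
    there too.\<close>
  have char_UP: "add_pow ?UP p \<one>\<^bsub>?UP\<^esub> = \<zero>\<^bsub>?UP\<^esub>"
    using const.hom_add_pow_nat[of \<one> p] char by simp
  have count: "count (roots P) a = 1" if a: "a \<in># roots P" for a
  proof (rule ccontr)
    assume "count (roots P) a \<noteq> 1"
    moreover have "count (roots P) a > 0"
      using a by simp
    ultimately have "2 \<le> alg_mult P a"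
      unfolding alg_mult_eq_count_roots[OF P] by linarith
    have a': "a \<in> carrier L" "a [^] q = a"
      using a root_iff by auto
    define l where "l = [\<one>, \<ominus> a]"
    define c where "c = poly_of_const a"
    have c: "c \<in> carrier ?UP" "c [^]\<^bsub>?UP\<^esub> q = c"
      using a' const.hom_nat_pow[of a q] by (auto simp: c_def)
    \<comment> \<open>The case distinction is due to the constant polynomial 0 being the empty list
      of coefficients.\<close>
    have l: "l = X \<ominus>\<^bsub>?UP\<^esub> c"
      using a' X c(1) univ_poly_a_inv_def'[OF carrier_is_subring c(1)]
      by (cases "a = \<zero>")
        (auto simp: l_def a_minus_def univ_poly_add univ_poly_zero var_def c_def poly_of_const_def)
    have lc: "l \<in> carrier ?UP" "l \<noteq> \<zero>\<^bsub>?UP\<^esub>"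
      using X c unfolding l by (simp) (simp add: l[symmetric] l_def univ_poly_zero)
    have "l [^]\<^bsub>?UP\<^esub> (2::nat) pdivides P"
      unfolding l_def using le_alg_mult_imp_pdivides[OF a'(1) P \<open>2 \<le> alg_mult P a\<close>] .
    then obtain V where V: "V \<in> carrier ?UP" "P = l [^]\<^bsub>?UP\<^esub> (2::nat) \<otimes>\<^bsub>?UP\<^esub> V"
      unfolding pdivides_def by blast
    obtain m where m: "q = Suc m"
      using q by (cases q) auto
    \<comment> \<open>Frobenius sends X - c to X^q - c^q, and c^q = c because a is fixed.\<close>
    have "l [^]\<^bsub>?UP\<^esub> q = X [^]\<^bsub>?UP\<^esub> q \<ominus>\<^bsub>?UP\<^esub> c"
      unfolding l a_minus_def q_def 
      using UP.frobenius[OF p char_UP X, of "\<ominus>\<^bsub>?UP\<^esub> c" k] 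
        UP.frobenius_uminus[OF p char_UP c(1), of k] c unfolding q_def by simp
    then have "P = l [^]\<^bsub>?UP\<^esub> q \<ominus>\<^bsub>?UP\<^esub> l"
      using X c UP.a_comm[of "\<ominus>\<^bsub>?UP\<^esub> X" c] unfolding P_def l
      by (simp add: a_minus_def UP.minus_add UP.a_assoc UP.r_neg1)
    also have "\<dots> = l \<otimes>\<^bsub>?UP\<^esub> (l [^]\<^bsub>?UP\<^esub> m \<ominus>\<^bsub>?UP\<^esub> \<one>\<^bsub>?UP\<^esub>)"
      using lc unfolding m by (simp add: a_minus_def UP.r_distr UP.r_minus UP.m_comm)
    also have "P = l \<otimes>\<^bsub>?UP\<^esub> (l \<otimes>\<^bsub>?UP\<^esub> V)"
      using V lc by (simp add: numeral_2_eq_2 UP.m_assoc)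
    \<comment> \<open>One factor \<open>l\<close> is cancelled; a multiple root leaves another one,
      so the cofactor would vanish at a.\<close>
    finally have *: "l \<otimes>\<^bsub>?UP\<^esub> V = l [^]\<^bsub>?UP\<^esub> m \<ominus>\<^bsub>?UP\<^esub> \<one>\<^bsub>?UP\<^esub>"
      using lc V by (subst (asm) UP.m_lcancel) auto
    interpret ev: ring_hom_ring ?UP L "\<lambda>p. eval p a"
      by (rule eval_ring_hom[OF carrier_is_subring a'(1)])
    have ev_l: "eval l a = \<zero>"
      using a' by (simp add: l_def r_neg)
    have "eval (l \<otimes>\<^bsub>?UP\<^esub> V) a = \<zero>"
      using ev.hom_mult[OF lc(1) V(1)] ev.hom_closed[OF V(1)] ev_l by simp
    moreover have "eval (l [^]\<^bsub>?UP\<^esub> m \<ominus>\<^bsub>?UP\<^esub> \<one>\<^bsub>?UP\<^esub>) a = \<zero> [^] m \<ominus> \<one>"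
      using lc ev.hom_nat_pow[OF lc(1), of m] ev_l by (simp add: a_minus_def del: ev.hom_nat_pow)
    \<comment> \<open>This uses q > 1, which makes \<open>m\<close> positive.\<close>
    moreover have "\<zero> [^] m = \<zero>"
      using q m by (simp add: nat_pow_zero)
    ultimately show False
      using * zero_not_one by (metis a_minus_def add.inv_eq_1_iff l_zero add.inv_closed one_closed)
  qed
  have "q = (\<Sum>a\<in>set_mset (roots P). count (roots P) a)"
    using size by (simp add: size_multiset_overloaded_eq)
  also have "\<dots> = card (set_mset (roots P))"
    using count by simp
  also have "set_mset (roots P) = {x \<in> carrier L. x [^] q = x}"
    using root_iff by auto
  finally show ?thesis
    unfolding q_def by (rule sym)
qed

text \<open>The structure is carried along an injection into the naturals, because
  \<open>finite_field\<close> chooses among rings of type \<open>nat ring\<close>.\<close>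

lemma (in field) finite_subfield_nat_copy:
  assumes "subfield K R" "finite K"
  shows "\<exists>F :: nat ring. field F \<and> card (carrier F) = card K"
proof -
  obtain f :: "'a \<Rightarrow> nat" where f: "inj_on f K"
    using assms(2) finite_imp_inj_to_nat_seg by blast
  interpret K: field "R\<lparr>carrier := K\<rparr>"
    using subfield_iff(2)[OF assms(1)] .
  have "field (image_ring f (R\<lparr>carrier := K\<rparr>))"
    using K.inj_imp_image_ring_is_field[of f] f by simp
  moreover have "card (carrier (image_ring f (R\<lparr>carrier := K\<rparr>))) = card K"
    using card_image[OF f] by (simp add: image_ring_carrier)
  ultimately show ?thesis
    by blast
qed

text \<open>The field consists of the fixed points of x -> x^(p^k) in an algebraic closure of Z/p.
  Its existence gives the choice in \<open>finite_field\<close> its intended meaning.\<close>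

lemma exists_field_of_prime_power_card:
  fixes p :: nat
  assumes p: "prime p" and k: "k \<ge> 1"
  shows "\<exists>R :: nat ring. field R \<and> card (carrier R) = p ^ k"
proof -
  interpret residues_prime p "residue_ring p"
    using p by unfold_locales auto
  let ?F = "residue_ring p"
  interpret ac: algebraic_closure alg_closure "indexed_const ` carrier ?F"
    by (rule alg_closureE(1))
  interpret ac: algebraically_closed alg_closure ..
  interpret h: ring_hom_ring ?F alg_closure indexed_const
    using alg_closureE(2) by unfold_locales
  \<comment> \<open>The order of the additive group of Z/p annihilates 1, and the embedding
    transports this to the closure.\<close>
  have "Coset.order (add_monoid ?F) = p"
    by (simp add: Coset.order_def res_carrier_eq)
  then have "add_pow ?F p \<one>\<^bsub>?F\<^esub> = \<zero>\<^bsub>?F\<^esub>"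
    using add.pow_order_eq_1[of "\<one>\<^bsub>?F\<^esub>"] by simp
  then have char: "add_pow alg_closure p \<one>\<^bsub>alg_closure\<^esub> = \<zero>\<^bsub>alg_closure\<^esub>"
    using h.hom_add_pow_nat[of "\<one>\<^bsub>?F\<^esub>" p] by simp
  let ?S = "{x \<in> carrier alg_closure. x [^]\<^bsub>alg_closure\<^esub> (p ^ k) = x}"
  have card: "card ?S = p ^ k"
    using ac.card_frobenius_fixed[OF p char k] .
  have "finite ?S"
    using card p by (intro card_ge_0_finite) (simp add: prime_gt_0_nat)
  from ac.finite_subfield_nat_copy[OF ac.subfield_frobenius_fixed[OF p char] this]
  show ?thesis
    unfolding card .
qed

section \<open>Counting weighted orbits\<close>

lemma phi'_eq_totient: "phi' m = totient m"
proof -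
  have "{x. 1 \<le> x \<and> x \<le> m \<and> coprime x m} = totatives m"
    by (auto simp: totatives_def)
  then show ?thesis
    by (simp add: phi'_def totient_def)
qed

text \<open>The group is cyclic, so a suitable power of a generator has order d;
  \<open>num_elems_of_ord_eq_phi'\<close> asks for one such element.\<close>

lemma (in field) card_elements_of_ord:
  assumes "finite (carrier R)" "d dvd Coset.order (mult_of R)"
  shows "card {a \<in> carrier (mult_of R). group.ord (mult_of R) a = d} = totient d"
proof -
  interpret G: group "mult_of R"
    by (rule field_mult_group)
  let ?N = "Coset.order (mult_of R)"
  have fin: "finite (carrier (mult_of R))"
    using assms(1) by simp
  then have N: "?N > 0"
    using G.order_gt_0_iff_finite by blast
  obtain a where a: "a \<in> carrier (mult_of R)"
    "carrier (mult_of R) = {a [^] i | i :: nat. i \<in> UNIV}"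
    using finite_field_mult_group_has_gen[OF assms(1)] by blast
  have "carrier (mult_of R) = {a [^]\<^bsub>mult_of R\<^esub> i | i :: nat. i \<in> {0..G.ord a - 1}}"
    using a(2) G.ord_elems[OF fin a(1)] by (simp add: Multiplicative_Group.nat_pow_mult_of)
  also have "\<dots> = (\<lambda>i. a [^]\<^bsub>mult_of R\<^esub> i) ` {0..G.ord a - 1}"
    by blast
  \<comment> \<open>The powers of \<open>a\<close> exhaust the group, so the group order is at most
    that of \<open>a\<close>.\<close>
  finally have "?N \<le> card {0..G.ord a - 1}"
    unfolding Coset.order_def by (metis card_image_le finite_atLeastAtMost)
  then have ord_a: "G.ord a = ?N"
    using G.ord_ge_1[OF fin a(1)] G.ord_le_group_order[OF fin a(1)] by simp
  obtain m where m: "?N = d * m"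
    using assms(2) by auto
  have "G.ord (a [^]\<^bsub>mult_of R\<^esub> m) = d"
    using G.ord_pow[of a m] a(1) m ord_a N by simp
  then show ?thesis
    using num_elems_of_ord_eq_phi'[OF assms] a(1) unfolding phi'_eq_totient by blast
qed

text \<open>Elements are sorted by their order; this turns Burnside's sum over the group into a
  divisor sum.\<close>

lemma (in field) sum_over_ord:
  fixes f :: "nat \<Rightarrow> nat"
  assumes "finite (carrier R)"
  shows "(\<Sum>a\<in>carrier (mult_of R). f (group.ord (mult_of R) a)) =
    (\<Sum>d | d dvd card (carrier R) - 1. totient d * f d)"
proof -
  interpret G: group "mult_of R"
    by (rule field_mult_group)
  let ?N = "Coset.order (mult_of R)"
  have fin: "finite (carrier (mult_of R))"
    using assms(1) by simp
  then have N: "?N > 0"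
    using G.order_gt_0_iff_finite by blast
  have "(\<Sum>a\<in>carrier (mult_of R). f (G.ord a)) =
      (\<Sum>d | d dvd ?N. \<Sum>a | a \<in> carrier (mult_of R) \<and> G.ord a = d. f (G.ord a))"
    using fin N G.ord_dvd_group_order by (intro sum.group[symmetric]) (auto intro!: finite_divisors_nat)
  also have "\<dots> = (\<Sum>d | d dvd ?N. totient d * f d)"
    using card_elements_of_ord[OF assms] by (intro sum.cong) auto
  also have "?N = card (carrier R) - 1"
    using order_mult_of[OF assms] by (simp add: Coset.order_def)
  finally show ?thesis .
qed

section \<open>The weighted action and its fixed vectors\<close>

lemma (in field) weighted_action_closed:
  assumes "c \<in> carrier (mult_of R)" "x \<in> nonzero_vectors R n"
  shows "weighted_action R n w c x \<in> nonzero_vectors R n"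
proof -
  have c: "c [^] (w i) \<in> carrier R - {\<zero>}" for i
    using monoid.nat_pow_closed[OF group.is_monoid[OF field_mult_group] assms(1), of "w i"]
    by (simp add: Multiplicative_Group.nat_pow_mult_of)
  obtain i where i: "i \<le> n" "x i \<noteq> \<zero>"
    using assms(2) unfolding nonzero_vectors_def
    by (auto simp: restrict_def fun_eq_iff PiE_def extensional_def split: if_splits)
  then have "x i \<in> carrier R"
    using assms(2) by (auto simp: nonzero_vectors_def)
  then have "c [^] (w i) \<otimes> x i \<noteq> \<zero>"
    using c[of i] i by (auto simp: integral_iff)
  then show ?thesis
    using assms(2) c i unfolding weighted_action_def nonzero_vectors_def
    by (auto simp: fun_eq_iff)
qed

lemma (in field) weighted_action_one:
  assumes "x \<in> nonzero_vectors R n"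
  shows "weighted_action R n w \<one> x = x"
  using assms unfolding weighted_action_def nonzero_vectors_def
  by (auto simp: fun_eq_iff PiE_def extensional_def Pi_def)

lemma (in field) weighted_action_mult:
  assumes "c \<in> carrier (mult_of R)" "d \<in> carrier (mult_of R)" "x \<in> nonzero_vectors R n"
  shows "weighted_action R n w (c \<otimes> d) x = weighted_action R n w c (weighted_action R n w d x)"
  using weighted_action_closed[OF assms(2,3), of w] assms
  unfolding weighted_action_def nonzero_vectors_def
  by (auto simp: fun_eq_iff PiE_def extensional_def Pi_def nat_pow_distrib m_assoc)

lemma (in field) weighted_action_group_action:
  "group_action (mult_of R) (nonzero_vectors R n) (weighted_action R n w)"
proof -
  let ?E = "nonzero_vectors R n" and ?\<phi> = "weighted_action R n w"
  interpret G: group "mult_of R"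
    by (rule field_mult_group)
  have inverse: "?\<phi> (inv\<^bsub>mult_of R\<^esub> c) (?\<phi> c x) = x" "?\<phi> c (?\<phi> (inv\<^bsub>mult_of R\<^esub> c) x) = x"
    if "c \<in> carrier (mult_of R)" "x \<in> ?E" for c x
    using weighted_action_mult[OF _ _ that(2), of "inv\<^bsub>mult_of R\<^esub> c" c w]
      weighted_action_mult[OF _ _ that(2), of c "inv\<^bsub>mult_of R\<^esub> c" w]
      G.l_inv[OF that(1)] G.r_inv[OF that(1)] G.inv_closed[OF that(1)] that
    by (simp_all add: weighted_action_one)
  have bij: "?\<phi> c \<in> Bij ?E" if c: "c \<in> carrier (mult_of R)" for c
  proof -
    have "bij_betw (?\<phi> c) ?E ?E"
      using inverse[OF c] weighted_action_closed[OF c]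
        weighted_action_closed[OF G.inv_closed[OF c]]
      by (intro bij_betw_byWitness[where f' = "?\<phi> (inv\<^bsub>mult_of R\<^esub> c)"]) auto
    then show ?thesis
      by (simp add: Bij_def weighted_action_def)
  qed
  show ?thesis
  proof (intro group_action.intro group_hom.intro group_hom_axioms.intro group_BijGroup
      field_mult_group homI)
    fix c d assume cd: "c \<in> carrier (mult_of R)" "d \<in> carrier (mult_of R)"
    have "?\<phi> (c \<otimes> d) = compose ?E (?\<phi> c) (?\<phi> d)"
    proof (rule extensionalityI)
      show "?\<phi> (c \<otimes> d) \<in> extensional ?E"
        by (simp add: weighted_action_def)
    qed (use cd in \<open>auto simp: weighted_action_mult compose_eq\<close>)
    then show "?\<phi> (c \<otimes>\<^bsub>mult_of R\<^esub> d) = ?\<phi> c \<otimes>\<^bsub>BijGroup ?E\<^esub> ?\<phi> d"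
      using bij[OF cd(1)] bij[OF cd(2)] by (simp add: BijGroup_def)
  qed (use bij in \<open>simp add: BijGroup_def\<close>)
qed

text \<open>In a field (c^w_i - 1) x_i = 0 forces x_i = 0 unless the order of c divides w_i, in
  which case x_i is free. The subtracted 1 is the zero vector.\<close>

lemma (in field) card_weighted_invariants:
  assumes "finite (carrier R)" "c \<in> carrier (mult_of R)"
  shows "card (invariants (nonzero_vectors R n) (weighted_action R n w) c) =
    card (carrier R) ^ card {i. i \<le> n \<and> group.ord (mult_of R) c dvd w i} - 1"
proof -
  interpret G: group "mult_of R"
    by (rule field_mult_group)
  define I where "I = {i. i \<le> n \<and> G.ord c dvd w i}"
  have c: "c \<in> carrier R" "c \<noteq> \<zero>"
    using assms(2) by auto
  have pow: "c [^] (w i) = \<one> \<longleftrightarrow> G.ord c dvd w i" for i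
    using G.pow_eq_id[OF assms(2), of "w i"] by (simp add: Multiplicative_Group.nat_pow_mult_of)
  have fixed: "c [^] (w i) \<otimes> y = y \<longleftrightarrow> G.ord c dvd w i \<or> y = \<zero>" if "y \<in> carrier R" for i y
  proof -
    have "(c [^] (w i) \<ominus> \<one>) \<otimes> y = c [^] (w i) \<otimes> y \<ominus> y"
      using that c by (simp add: a_minus_def l_distr l_minus)
    then have "c [^] (w i) \<otimes> y = y \<longleftrightarrow> (c [^] (w i) \<ominus> \<one>) \<otimes> y = \<zero>"
      using that c by simp
    also have "\<dots> \<longleftrightarrow> c [^] (w i) \<ominus> \<one> = \<zero> \<or> y = \<zero>"
      using that c by (intro integral_iff) auto
    finally show ?thesis
      using pow c by simp
  qed
  define F where "F = PiE {..n} (\<lambda>i. if i \<in> I then carrier R else {\<zero>})"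
  have "invariants (nonzero_vectors R n) (weighted_action R n w) c = F - {\<lambda>i\<in>{..n}. \<zero>}"
  proof (rule Set.set_eqI)
    fix x
    have "(\<lambda>i\<in>{..n}. c [^] w i \<otimes> x i) = x \<longleftrightarrow> (\<forall>i\<le>n. c [^] w i \<otimes> x i = x i)"
      if "x \<in> {..n} \<rightarrow>\<^sub>E carrier R"
      using that by (auto simp: fun_eq_iff PiE_def extensional_def)
    moreover have "F \<subseteq> {..n} \<rightarrow>\<^sub>E carrier R"
      unfolding F_def by (intro PiE_mono) auto
    moreover have "x \<in> F \<longleftrightarrow> (\<forall>i\<le>n. c [^] w i \<otimes> x i = x i)" if "x \<in> {..n} \<rightarrow>\<^sub>E carrier R"
      using that fixed unfolding F_def I_def
      by (auto simp: PiE_iff split: if_splits)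
    ultimately show "x \<in> invariants (nonzero_vectors R n) (weighted_action R n w) c \<longleftrightarrow>
        x \<in> F - {\<lambda>i\<in>{..n}. \<zero>}"
      unfolding invariants_def nonzero_vectors_def weighted_action_def by auto
  qed
  moreover have "(\<lambda>i\<in>{..n}. \<zero>) \<in> F"
    by (auto simp: F_def)
  moreover have "card F = card (carrier R) ^ card I"
  proof -
    have "card F = (\<Prod>i\<le>n. if i \<in> I then card (carrier R) else 1)"
      unfolding F_def by (subst card_PiE) (auto intro!: prod.cong)
    also have "\<dots> = (\<Prod>i\<in>{..n} \<inter> I. card (carrier R))"
      by (rule prod.inter_restrict[symmetric]) simp
    also have "{..n} \<inter> I = I"
      by (auto simp: I_def)
    finally show ?thesis by simp
  qed
  ultimately show ?thesis
    unfolding I_def by simp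
qed

text \<open>Burnside's lemma, kept in multiplied form so that no division of naturals is
  involved.\<close>

lemma (in field) num_weighted_orbits_times:
  assumes "finite (carrier R)"
  shows "num_weighted_orbits R n w * (card (carrier R) - 1) =
    (\<Sum>d | d dvd card (carrier R) - 1.
      totient d * (card (carrier R) ^ card {i. i \<le> n \<and> d dvd w i} - 1))"
proof -
  interpret group_action "mult_of R" "nonzero_vectors R n" "weighted_action R n w"
    by (rule weighted_action_group_action)
  have "finite (nonzero_vectors R n)"
    unfolding nonzero_vectors_def using assms by (auto intro!: finite_PiE)
  then have "num_weighted_orbits R n w * Coset.order (mult_of R) =
      (\<Sum>c\<in>carrier (mult_of R). card (invariants (nonzero_vectors R n) (weighted_action R n w) c))"
    unfolding num_weighted_orbits_def using assms by (intro burnside) auto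
  also have "\<dots> = (\<Sum>c\<in>carrier (mult_of R).
      card (carrier R) ^ card {i. i \<le> n \<and> group.ord (mult_of R) c dvd w i} - 1)"
    using card_weighted_invariants[OF assms] by (intro sum.cong) auto
  also have "\<dots> = (\<Sum>d | d dvd card (carrier R) - 1.
      totient d * (card (carrier R) ^ card {i. i \<le> n \<and> d dvd w i} - 1))"
    by (rule sum_over_ord[OF assms])
  also have "Coset.order (mult_of R) = card (carrier R) - 1"
    using order_mult_of[OF assms] by (simp add: Coset.order_def)
  finally show ?thesis .
qed

text \<open>Each Q^m - 1 is Q - 1 times a geometric sum, and Q - 1 cancels because 0 and 1 are
  distinct elements.\<close>

lemma (in field) num_weighted_orbits_eq:
  assumes "finite (carrier R)"
  shows "num_weighted_orbits R n w =
    (\<Sum>d | d dvd card (carrier R) - 1.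
      totient d * (\<Sum>j<card {i. i \<le> n \<and> d dvd w i}. card (carrier R) ^ j))"
proof -
  let ?Q = "card (carrier R)"
  have "card {\<zero>, \<one>} \<le> ?Q"
    using assms by (intro card_mono) auto
  then have Q: "?Q > 1" by simp
  have geometric: "?Q ^ m - 1 = (\<Sum>j<m. ?Q ^ j) * (?Q - 1)" for m
  proof -
    obtain r where "?Q = Suc r"
      using Q by (metis less_imp_Suc_add)
    then have "?Q ^ m = (\<Sum>j<m. ?Q ^ j) * (?Q - 1) + 1"
      by (induction m) (simp_all add: algebra_simps)
    then show ?thesis
      by simp
  qed
  show ?thesis
    using num_weighted_orbits_times[OF assms, of n w] Q
    unfolding geometric mult.assoc[symmetric] sum_distrib_right[symmetric] by simp
qed

lemma twist_count_eq:
  assumes "prime p" "k \<ge> 1" "Q = p ^ k"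
  shows "twist_count n w Q =
    (\<Sum>d | d dvd Q - 1. totient d * (\<Sum>j<card {i. i \<le> n \<and> d dvd w i}. Q ^ j))"
proof -
  have "\<exists>R :: nat ring. field R \<and> card (carrier R) = Q"
    using exists_field_of_prime_power_card assms by blast
  then have F: "field (finite_field Q)" "card (carrier (finite_field Q)) = Q"
    unfolding finite_field_def by (metis (mono_tags, lifting) someI_ex)+
  \<comment> \<open>An infinite carrier would have \<open>card\<close> equal to 0, so positivity
    yields finiteness.\<close>
  have "Q > 0"
    using assms by (simp add: prime_gt_0_nat)
  then have "finite (carrier (finite_field Q))"
    using F(2) by (metis card.infinite less_irrefl)
  then show ?thesis
    using field.num_weighted_orbits_eq[OF F(1)] F(2) by (simp add: twist_count_def)
qed

section \<open>Logarithmic derivatives of power series\<close>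

text \<open>The logarithmic derivative of the product of the (1 - \<alpha>t)^(-b(\<alpha>)), which
  explains the exponent \<open>Suc r\<close> at index r.\<close>

definition power_sum_fps :: "(complex \<Rightarrow> int) \<Rightarrow> complex fps" where
  "power_sum_fps b = Abs_fps (\<lambda>r. \<Sum>\<alpha> | b \<alpha> \<noteq> 0. of_int (b \<alpha>) * \<alpha> ^ Suc r)"

text \<open>The equation determines m times the m-th coefficient from the earlier ones, and m is
  invertible in characteristic 0.\<close>

lemma fps_deriv_ode_unique:
  fixes F G D :: "complex fps"
  assumes "fps_deriv F = F * D" "fps_deriv G = G * D" "F $ 0 = G $ 0"
  shows "F = G"
proof (rule fps_ext)
  fix m
  show "F $ m = G $ m"
  proof (induction m rule: less_induct)
    case (less m)
    show ?case
    proof (cases m)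
      case (Suc l)
      have "(F * D) $ l = (G * D) $ l"
        unfolding fps_mult_nth using less Suc by (intro sum.cong) auto
      then have "fps_deriv F $ l = fps_deriv G $ l"
        using assms by simp
      then show ?thesis
        using Suc by (simp add: fps_deriv_nth del: of_nat_Suc)
    qed (use assms in simp)
  qed
qed

text \<open>Here and below, F' = F * D expresses that D is the logarithmic derivative of F without
  forming a quotient.\<close>

lemma fps_log_deriv_power:
  fixes F D :: "complex fps"
  assumes "fps_deriv F = F * D"
  shows "fps_deriv (F ^ m) = F ^ m * (of_nat m * D)"
proof (induction m)
  case (Suc m)
  have "fps_deriv (F ^ Suc m) = F * (F ^ m * (of_nat m * D)) + F * D * F ^ m"
    by (simp only: power_Suc fps_deriv_mult Suc.IH assms)
  also have "\<dots> = F ^ Suc m * (of_nat (Suc m) * D)"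
    by (simp add: algebra_simps)
  finally show ?case .
qed simp

lemma fps_log_deriv_inverse:
  fixes F D :: "complex fps"
  assumes "fps_deriv F = F * D" "F $ 0 \<noteq> 0"
  shows "fps_deriv (inverse F) = inverse F * (- D)"
proof -
  let ?G = "inverse F"
  have FG: "F * ?G = 1"
    using inverse_mult_eq_1[OF assms(2)] by (simp add: mult.commute)
  then have "fps_deriv (F * ?G) = 0"
    by simp
  then have "F * fps_deriv ?G = - (F * D * ?G)"
    by (simp add: assms(1) eq_neg_iff_add_eq_0)
  then have "?G * (F * fps_deriv ?G) = ?G * - (D * (F * ?G))"
    by (simp add: mult_ac)
  then show ?thesis
    using FG by (simp add: mult.assoc[symmetric] mult.commute[of ?G F])
qed

lemma fps_log_deriv_powi:
  fixes F D :: "complex fps"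
  assumes "fps_deriv F = F * D" "F $ 0 \<noteq> 0"
  shows "fps_deriv (F powi m) = F powi m * (of_int m * D)"
proof (cases "m \<ge> 0")
  case True
  then show ?thesis
    using fps_log_deriv_power[OF assms(1), of "nat m"] by (simp add: power_int_def)
next
  case False
  then have "fps_deriv (F powi m) = F powi m * (of_nat (nat (- m)) * (- D))"
    using fps_log_deriv_power[OF fps_log_deriv_inverse[OF assms], of "nat (- m)"]
    by (simp add: power_int_def del: of_nat_nat)
  then show ?thesis
    using False by simp
qed

lemma fps_log_deriv_prod:
  fixes F D :: "'b \<Rightarrow> complex fps"
  assumes "finite S" "\<And>a. a \<in> S \<Longrightarrow> fps_deriv (F a) = F a * D a"
  shows "fps_deriv (\<Prod>a\<in>S. F a) = (\<Prod>a\<in>S. F a) * (\<Sum>a\<in>S. D a)"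
  using assms
proof (induction S)
  case (insert a S)
  then have "fps_deriv (\<Prod>a\<in>insert a S. F a) =
      F a * ((\<Prod>a\<in>S. F a) * (\<Sum>a\<in>S. D a)) + F a * D a * (\<Prod>a\<in>S. F a)"
    by simp
  also have "\<dots> = (\<Prod>a\<in>insert a S. F a) * (\<Sum>a\<in>insert a S. D a)"
    using insert.hyps by (simp add: algebra_simps)
  finally show ?case .
qed simp

text \<open>The logarithmic derivative -\<alpha>/(1 - \<alpha>t) is written as a geometric
  series.\<close>

lemma fps_log_deriv_linear_factor:
  fixes \<alpha> :: complex
  shows "fps_deriv (1 - fps_const \<alpha> * fps_X) =
    (1 - fps_const \<alpha> * fps_X) * (- Abs_fps (\<lambda>r. \<alpha> ^ Suc r))"
proof (rule fps_ext)
  fix r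
  show "fps_deriv (1 - fps_const \<alpha> * fps_X) $ r =
      ((1 - fps_const \<alpha> * fps_X) * (- Abs_fps (\<lambda>r. \<alpha> ^ Suc r))) $ r"
    by (cases r) (simp_all add: left_diff_distrib mult.assoc)
qed

lemma fps_deriv_cyclotomic_product:
  assumes "finite {\<alpha>. b \<alpha> \<noteq> 0}"
  defines "F \<equiv> \<Prod>\<alpha> | b \<alpha> \<noteq> 0. (1 - fps_const \<alpha> * fps_X) powi (- b \<alpha>)"
  shows "fps_deriv F = F * power_sum_fps b" "F $ 0 = 1"
proof -
  have "fps_deriv F = F * (\<Sum>\<alpha> | b \<alpha> \<noteq> 0. of_int (- b \<alpha>) * (- Abs_fps (\<lambda>r. \<alpha> ^ Suc r)))"
    unfolding F_def using assms(1)
    by (intro fps_log_deriv_prod fps_log_deriv_powi fps_log_deriv_linear_factor) auto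
  also have "(\<Sum>\<alpha> | b \<alpha> \<noteq> 0. of_int (- b \<alpha>) * (- Abs_fps (\<lambda>r. \<alpha> ^ Suc r))) = power_sum_fps b"
    by (rule fps_ext) (simp add: power_sum_fps_def fps_sum_nth fps_of_int[symmetric])
  finally show "fps_deriv F = F * power_sum_fps b" .
  have "((1 - fps_const \<alpha> * fps_X) powi (- b \<alpha>)) $ 0 = 1" for \<alpha>
    by (simp add: power_int_def fps_power_zeroth)
  then have "(\<Prod>\<alpha>\<in>S. (1 - fps_const \<alpha> * fps_X) powi (- b \<alpha>)) $ 0 = 1" for S
    by (induction S rule: infinite_finite_induct) simp_all
  then show "F $ 0 = 1"
    unfolding F_def .
qed

section \<open>The twist zeta function as a product determined by power sums\<close>

lemma twist_zeta_deriv: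
  "fps_deriv (twist_zeta n w q) = twist_zeta n w q * Abs_fps (\<lambda>r. of_nat (twist_count n w (q ^ Suc r)))"
  "twist_zeta n w q $ 0 = 1"
proof -
  define G :: "complex fps" where
    "G = Abs_fps (\<lambda>r. if r = 0 then 0 else of_nat (twist_count n w (q ^ r)) / of_nat r)"
  have "fps_deriv G = Abs_fps (\<lambda>r. of_nat (twist_count n w (q ^ Suc r)))"
    by (rule fps_ext) (simp add: G_def del: of_nat_Suc)
  moreover have "G $ 0 = 0"
    by (simp add: G_def)
  ultimately show "fps_deriv (twist_zeta n w q) =
      twist_zeta n w q * Abs_fps (\<lambda>r. of_nat (twist_count n w (q ^ Suc r)))"
    unfolding twist_zeta_def G_def[symmetric] by (simp add: fps_compose_deriv)
  show "twist_zeta n w q $ 0 = 1"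
    by (simp add: twist_zeta_def)
qed

text \<open>Both series have constant term 1, so they agree exactly when their logarithmic
  derivatives do; the coefficients of these are the orbit counts and the power sums.\<close>

lemma twist_zeta_eq_product_iff:
  assumes "finite {\<alpha>. b \<alpha> \<noteq> 0}"
  shows "twist_zeta n w q = (\<Prod>\<alpha> | b \<alpha> \<noteq> 0. (1 - fps_const \<alpha> * fps_X) powi (- b \<alpha>)) \<longleftrightarrow>
    (\<forall>r>0. of_nat (twist_count n w (q ^ r)) = (\<Sum>\<alpha> | b \<alpha> \<noteq> 0. of_int (b \<alpha>) * \<alpha> ^ r))"
    (is "?Z = ?F \<longleftrightarrow> ?P")
proof -
  let ?A = "Abs_fps (\<lambda>r. of_nat (twist_count n w (q ^ Suc r))) :: complex fps"
  have "?P \<longleftrightarrow> ?A = power_sum_fps b"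
    by (auto simp: fps_eq_iff power_sum_fps_def gr0_conv_Suc simp del: power_Suc)
  moreover have "?Z = ?F \<longleftrightarrow> ?A = power_sum_fps b"
  proof
    assume "?Z = ?F"
    then have "?Z * ?A = ?Z * power_sum_fps b"
      using twist_zeta_deriv(1)[of n w q] fps_deriv_cyclotomic_product(1)[OF assms] by metis
    moreover have "?Z \<noteq> 0"
      using twist_zeta_deriv(2)[of n w q] by auto
    ultimately show "?A = power_sum_fps b"
      by simp
  next
    assume "?A = power_sum_fps b"
    then show "?Z = ?F"
      using fps_deriv_ode_unique[OF twist_zeta_deriv(1)[of n w q]
        fps_deriv_cyclotomic_product(1)[OF assms, folded \<open>?A = power_sum_fps b\<close>]]
        twist_zeta_deriv(2)[of n w q] fps_deriv_cyclotomic_product(2)[OF assms]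
      by (simp only:)
  qed
  ultimately show ?thesis by simp
qed

text \<open>By linearity the relation extends from powers to all polynomials P, and a P that
  vanishes on T except at \<beta> isolates one coefficient. The factor \<alpha> left over from
  starting at exponent 1 is harmless because 0 is not in T.\<close>

lemma power_sums_eq_0D:
  fixes d :: "complex \<Rightarrow> complex"
  assumes "finite T" "0 \<notin> T" "\<And>r. (\<Sum>\<alpha>\<in>T. d \<alpha> * \<alpha> ^ Suc r) = 0" "\<beta> \<in> T"
  shows "d \<beta> = 0"
proof -
  have poly: "(\<Sum>\<alpha>\<in>T. d \<alpha> * \<alpha> * poly P \<alpha>) = 0" for P
  proof -
    have "(\<Sum>\<alpha>\<in>T. d \<alpha> * \<alpha> * poly P \<alpha>) =
        (\<Sum>\<alpha>\<in>T. \<Sum>i\<le>Polynomial.degree P. Polynomial.coeff P i * (d \<alpha> * \<alpha> ^ Suc i))"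
      by (simp add: poly_altdef sum_distrib_left mult_ac)
    also have "\<dots> = (\<Sum>i\<le>Polynomial.degree P. Polynomial.coeff P i * (\<Sum>\<alpha>\<in>T. d \<alpha> * \<alpha> ^ Suc i))"
      by (subst sum.swap) (simp only: sum_distrib_left)
    also have "\<dots> = 0"
      using assms(3) by simp
    finally show ?thesis .
  qed
  let ?P = "\<Prod>\<alpha>\<in>T - {\<beta>}. [:- \<alpha>, 1:]"
  have "(\<Sum>\<alpha>\<in>T. d \<alpha> * \<alpha> * poly ?P \<alpha>) = (\<Sum>\<alpha>\<in>{\<beta>}. d \<alpha> * \<alpha> * poly ?P \<alpha>)"
    using assms by (intro sum.mono_neutral_right) (auto simp: poly_prod)
  then have "d \<beta> * \<beta> * poly ?P \<beta> = 0"
    using poly by simp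
  moreover have "poly ?P \<beta> \<noteq> 0"
    using assms(1) by (auto simp: poly_prod)
  ultimately show ?thesis
    using assms(2,4) by auto
qed

lemma cyclotomic_factorization_nonzero:
  assumes "cyclotomic_factorization n q F b" "q > 0" "b \<alpha> \<noteq> 0"
  shows "\<alpha> \<noteq> 0"
proof -
  obtain \<zeta> j where "root_of_unity \<zeta>" "\<alpha> = \<zeta> * of_nat q ^ j"
    using assms unfolding cyclotomic_factorization_def by blast
  then show ?thesis
    using assms(2) by (auto simp: root_of_unity_def power_0_left)
qed

text \<open>Both functions have the orbit counts as power sums, so on the union of the supports
  their difference has vanishing power sums.\<close>

lemma cyclotomic_factorization_twist_zeta_unique:
  assumes "cyclotomic_factorization n q (twist_zeta n w q) b"
    and "cyclotomic_factorization n q (twist_zeta n w q) b'" and "q > 0"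
  shows "b = b'"
proof
  fix \<beta>
  let ?S = "{\<alpha>. b \<alpha> \<noteq> 0}" and ?S' = "{\<alpha>. b' \<alpha> \<noteq> 0}"
  have fin: "finite (?S \<union> ?S')"
    using assms unfolding cyclotomic_factorization_def by auto
  have "(\<Sum>\<alpha>\<in>?S \<union> ?S'. of_int (b \<alpha> - b' \<alpha>) * \<alpha> ^ Suc r) = (0::complex)" for r
  proof -
    have "(\<Sum>\<alpha>\<in>?S \<union> ?S'. of_int (b \<alpha>) * \<alpha> ^ Suc r) = (\<Sum>\<alpha>\<in>?S. of_int (b \<alpha>) * \<alpha> ^ Suc r)"
      using fin by (intro sum.mono_neutral_right) auto
    also have "\<dots> = of_nat (twist_count n w (q ^ Suc r))"
      using assms(1) twist_zeta_eq_product_iff[of b n w q] unfolding cyclotomic_factorization_def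
      by (metis zero_less_Suc)
    also have "\<dots> = (\<Sum>\<alpha>\<in>?S'. of_int (b' \<alpha>) * \<alpha> ^ Suc r)"
      using assms(2) twist_zeta_eq_product_iff[of b' n w q] unfolding cyclotomic_factorization_def
      by (metis zero_less_Suc)
    also have "\<dots> = (\<Sum>\<alpha>\<in>?S \<union> ?S'. of_int (b' \<alpha>) * \<alpha> ^ Suc r)"
      using fin by (intro sum.mono_neutral_left) auto
    finally show ?thesis
      by (simp add: left_diff_distrib sum_subtractf)
  qed
  moreover have "0 \<notin> ?S \<union> ?S'"
    using cyclotomic_factorization_nonzero assms by blast
  ultimately have "\<beta> \<in> ?S \<union> ?S' \<Longrightarrow> of_int (b \<beta> - b' \<beta>) = (0::complex)"
    using power_sums_eq_0D[OF fin, of "\<lambda>\<alpha>. of_int (b \<alpha> - b' \<alpha>)" \<beta>] by blast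
  then show "b \<beta> = b' \<beta>"
    by (cases "\<beta> \<in> ?S \<union> ?S'") auto
qed

section \<open>Functional equations\<close>

text \<open>The finitely many exceptions other than a form a closed set, whose complement is a
  neighbourhood of a.\<close>

lemma MOST_imp_eventually_at:
  fixes a :: "'a :: t1_space"
  assumes "\<forall>\<^sub>\<infinity>t. P t"
  shows "eventually P (at a)"
proof -
  have "finite {t. \<not> P t}"
    using assms by (simp add: eventually_cofinite)
  then have "open (- ({t. \<not> P t} - {a}))"
    by (intro open_Compl finite_imp_closed) auto
  then show ?thesis
    unfolding eventually_at_topological by (intro exI[of _ "- ({t. \<not> P t} - {a})"]) auto
qed

text \<open>The substitution exchanges 1 and q^(-n), where D vanishes to order at least two and
  exactly one. Sign +1 would make these orders equal; sign -1 would make D(t) D(1/(q^n t)) nonzero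
  at t = 1.\<close>

lemma no_global_functional_equation:
  fixes D E H :: "complex poly"
  assumes FD: "F * fps_of_poly D = 1" and q: "q > 0"
    and E: "D = [:1, -1:]\<^sup>2 * E"
    and H: "D = [:1, - (of_nat q ^ n):] * H" "poly H (1 / of_nat q ^ n) \<noteq> 0"
  shows "\<not> global_functional_equation n q F"
proof
  assume "global_functional_equation n q F"
  then obtain P Q C and s \<epsilon> :: int where PQ: "Q \<noteq> 0" "F * fps_of_poly Q = fps_of_poly P"
    and C: "C \<noteq> 0" and \<epsilon>: "\<epsilon> \<in> {1, -1}"
    and eq: "\<forall>\<^sub>\<infinity>t. poly P (1 / (of_nat q ^ n * t)) / poly Q (1 / (of_nat q ^ n * t)) =
       C * t powi s * (poly P t / poly Q t) powi \<epsilon>"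
    unfolding global_functional_equation_def Let_def by blast
  define N :: complex where "N = of_nat q ^ n"
  have N: "N \<noteq> 0"
    using q by (simp add: N_def)
  \<comment> \<open>Whatever representation P / Q was chosen, it is 1 / D with numerator and
    denominator multiplied by P.\<close>
  have "fps_of_poly Q = (F * fps_of_poly D) * fps_of_poly Q"
    using FD by simp
  also have "\<dots> = (F * fps_of_poly Q) * fps_of_poly D"
    by (simp only: mult_ac)
  also have "\<dots> = fps_of_poly (P * D)"
    by (simp only: PQ(2) fps_of_poly_mult)
  finally have Q: "Q = P * D"
    by (simp add: fps_of_poly_eq_iff)
  have fin: "finite {t. poly Q t = 0}"
    using PQ(1) by (rule poly_roots_finite)
  \<comment> \<open>The map t -> 1/(Nt) is an involution away from 0, so it pulls the roots of Q
    back to finitely many points.\<close>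
  have "{t. t \<noteq> 0 \<and> poly Q (1 / (N * t)) = 0} \<subseteq> (\<lambda>u. 1 / (N * u)) ` {t. poly Q t = 0}"
  proof
    fix t assume t: "t \<in> {t. t \<noteq> 0 \<and> poly Q (1 / (N * t)) = 0}"
    then have "t = 1 / (N * (1 / (N * t)))"
      using N by simp
    then show "t \<in> (\<lambda>u. 1 / (N * u)) ` {t. poly Q t = 0}"
      using t by blast
  qed
  then have "finite {t. t \<noteq> 0 \<and> poly Q (1 / (N * t)) = 0}"
    using fin by (meson finite_imageI finite_subset)
  then have "\<forall>\<^sub>\<infinity>t. t = 0 \<or> poly Q (1 / (N * t)) \<noteq> 0"
    by (simp add: eventually_cofinite)
  moreover have "\<forall>\<^sub>\<infinity>t. poly Q t \<noteq> 0"
    using fin by (simp add: eventually_cofinite)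
  moreover have "\<forall>\<^sub>\<infinity>t. t \<noteq> (0::complex)" "\<forall>\<^sub>\<infinity>t. t \<noteq> (1::complex)"
    by (simp_all add: eventually_cofinite)
  \<comment> \<open>Where Q = P * D does not vanish, neither does P, which therefore
    cancels.\<close>
  ultimately have "\<forall>\<^sub>\<infinity>t. t \<noteq> 0 \<and> t \<noteq> 1 \<and> poly D t \<noteq> 0 \<and> poly D (1 / (N * t)) \<noteq> 0 \<and>
      1 / poly D (1 / (N * t)) = C * t powi s * (1 / poly D t) powi \<epsilon>"
    using eq unfolding N_def[symmetric]
    by eventually_elim (auto simp: Q)
  from MOST_imp_eventually_at[OF this, of 1]
  have ev: "\<forall>\<^sub>F t in at 1. t \<noteq> 0 \<and> t \<noteq> 1 \<and> poly D t \<noteq> 0 \<and> poly D (1 / (N * t)) \<noteq> 0 \<and>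
      1 / poly D (1 / (N * t)) = C * t powi s * (1 / poly D t) powi \<epsilon>" .
  have tendsto: "(\<lambda>t. poly R (1 / (N * t))) \<midarrow>1\<rightarrow> poly R (1 / N)"
    "poly R \<midarrow>1\<rightarrow> poly R 1" for R
    using N by (auto intro!: tendsto_eq_intros)
  have powi: "(\<lambda>t. t powi s) \<midarrow>1\<rightarrow> (1::complex)"
    using tendsto_power_int[OF tendsto_ident_at[of "1::complex" UNIV], of s] by simp
  from \<epsilon> show False
  proof (elim insertE emptyE)
    assume \<epsilon>: "\<epsilon> = 1"
    have clear_denominators: "x = c * y" if "x \<noteq> 0" "y \<noteq> 0" "1 / y = c / x" for x y c :: complex
      using that by (simp add: field_simps)
    have "\<forall>\<^sub>F t in at 1. (t - 1) * poly E t * t = C * t powi s * poly H (1 / (N * t))"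
      using ev
    proof eventually_elim
      case (elim t)
      have "poly D t = (t - 1)\<^sup>2 * poly E t"
        unfolding E by (simp add: power2_eq_square algebra_simps)
      \<comment> \<open>The linear factor is 1 - N/(Nt) = (t - 1)/t.\<close>
      moreover have "poly D (1 / (N * t)) = (t - 1) / t * poly H (1 / (N * t))"
        using elim N unfolding H(1) N_def[symmetric] by (simp add: field_simps)
      moreover have "poly D t = C * t powi s * poly D (1 / (N * t))"
        using elim \<epsilon> clear_denominators[of "poly D t" "poly D (1 / (N * t))" "C * t powi s"] by simp
      ultimately have "(t - 1) * ((t - 1) * poly E t) =
          (t - 1) * (C * t powi s * poly H (1 / (N * t)) / t)"
        by (simp add: power2_eq_square mult_ac)
      then have "(t - 1) * poly E t = C * t powi s * poly H (1 / (N * t)) / t"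
        by (subst (asm) mult_left_cancel) (use elim in auto)
      then show ?case
        using elim by simp
    qed
    \<comment> \<open>After one factor t - 1 is cancelled, the second sends the left side to 0,
      while the right side tends to a nonzero multiple of H(1/N).\<close>
    moreover have "(\<lambda>t. (t - 1) * poly E t * t) \<midarrow>1\<rightarrow> (1 - 1) * poly E 1 * 1"
      by (intro tendsto_intros)
    ultimately have "(\<lambda>t. C * t powi s * poly H (1 / (N * t))) \<midarrow>1\<rightarrow> (1 - 1) * poly E 1 * 1"
      by (rule Lim_transform_eventually[rotated])
    moreover have "(\<lambda>t. C * t powi s * poly H (1 / (N * t))) \<midarrow>1\<rightarrow> C * 1 * poly H (1 / N)"
      by (intro tendsto_intros tendsto powi)
    ultimately have "(1 - 1) * poly E 1 * 1 = C * 1 * poly H (1 / N)"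
      by (rule LIM_unique)
    then show False
      using C H(2) by (simp add: N_def)
  next
    assume \<epsilon>: "\<epsilon> = -1"
    have clear_denominators: "c * x * y = 1" if "y \<noteq> 0" "1 / y = c * x" for x y c :: complex
      using that(2)[symmetric] that(1) by simp
    have "\<forall>\<^sub>F t in at 1. C * t powi s * poly D t * poly D (1 / (N * t)) = 1"
      using ev by eventually_elim (rule clear_denominators, use \<epsilon> in \<open>simp_all add: power_int_minus\<close>)
    moreover have "(\<lambda>t. C * t powi s * poly D t * poly D (1 / (N * t))) \<midarrow>1\<rightarrow>
        C * 1 * poly D 1 * poly D (1 / N)"
      by (intro tendsto_intros tendsto powi)
    ultimately have "(\<lambda>t. 1) \<midarrow>(1::complex)\<rightarrow> C * 1 * poly D 1 * poly D (1 / N)"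
      by (rule Lim_transform_eventually[rotated])
    then have "1 = C * 1 * poly D 1 * poly D (1 / N)"
      by (simp add: tendsto_const_iff)
    moreover have "poly D 1 = 0"
      by (simp add: E)
    ultimately show False
      by simp
  qed
qed

section \<open>Reciprocal poles of the twist zeta function\<close>

text \<open>Orthogonality: if some m-th root of unity y has y^r different from 1, multiplication by
  y permutes the roots and scales the sum by y^r.\<close>

lemma sum_powers_roots_unity:
  assumes "m > 0"
  shows "(\<Sum>z | z ^ m = 1. z ^ r) = (if m dvd r then of_nat m else (0::complex))"
proof (cases "m dvd r")
  case True
  then have "(\<Sum>z | z ^ m = 1. z ^ r) = (\<Sum>z::complex | z ^ m = 1. 1 :: complex)"
    by (intro sum.cong) (auto simp: power_mult)
  also have "\<dots> = of_nat m"
    using card_roots_unity_eq[OF assms] by simp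
  finally show ?thesis using True by simp
next
  case False
  \<comment> \<open>Otherwise, by Bezout, all m-th roots of unity would be roots of unity of the
    smaller exponent gcd(m, r), and there are too many of them.\<close>
  have "\<exists>y::complex. y ^ m = 1 \<and> y ^ r \<noteq> 1"
  proof (rule ccontr)
    assume *: "\<nexists>y::complex. y ^ m = 1 \<and> y ^ r \<noteq> 1"
    obtain x y where xy: "m * x = r * y + gcd m r"
      using bezout_nat[of m r] assms by auto
    have gcd: "gcd m r > 0"
      using assms by simp
    have "z ^ gcd m r = 1" if "z ^ m = 1" for z :: complex
    proof -
      have "z ^ (m * x) = 1" "z ^ (r * y) = 1"
        using that * by (auto simp: power_mult)
      then show ?thesis
        by (simp add: xy power_add)
    qed
    then have "card {z::complex. z ^ m = 1} \<le> card {z::complex. z ^ gcd m r = 1}"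
      using finite_roots_unity[of "gcd m r"] gcd by (intro card_mono) auto
    then have "m \<le> gcd m r"
      using card_roots_unity_eq[OF assms] card_roots_unity_eq[OF gcd] by simp
    then have "gcd m r = m"
      using assms by (meson dvd_imp_le gcd_dvd1 le_antisym)
    then show False
      using False by (metis gcd_dvd2)
  qed
  then obtain y :: complex where y: "y ^ m = 1" "y ^ r \<noteq> 1"
    by blast
  then have "y \<noteq> 0"
    using assms by (auto simp: power_0_left)
  let ?S = "\<Sum>z | z ^ m = 1. z ^ r :: complex"
  have "bij_betw (\<lambda>z. y * z) {z. z ^ m = 1} {z. z ^ m = 1}"
    using y \<open>y \<noteq> 0\<close>
    by (intro bij_betw_byWitness[where f' = "\<lambda>z. z / y"]) (auto simp: power_mult_distrib power_divide)
  then have "?S = (\<Sum>z | z ^ m = 1. (y * z) ^ r)"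
    by (rule sum.reindex_bij_betw[symmetric])
  also have "\<dots> = y ^ r * ?S"
    by (simp add: power_mult_distrib sum_distrib_left)
  finally have "?S = 0"
    using y(2) by (metis mult_cancel_right1)
  then show ?thesis
    using False by simp
qed

section \<open>Explicit multiplicities of the reciprocal poles\<close>

locale weighted_projective_stack =
  fixes p n k q :: nat and w :: "nat \<Rightarrow> nat"
  assumes p: "prime p" and k: "k \<ge> 1" and q: "q = p ^ k"
    and w: "\<And>i. i \<le> n \<Longrightarrow> w i > 0"
begin

text \<open>The moduli prime to p whose geometric sum in the orbit count reaches the power
  Q^j.\<close>

definition level_moduli :: "nat \<Rightarrow> nat set" where
  "level_moduli j = {e. coprime e p \<and> j < card {i. i \<le> n \<and> e dvd w i}}"

text \<open>Each modulus e spreads a total of \<phi>(e) evenly over the roots of unity of exponent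
  \<open>ord e q\<close>. The division is exact since this order divides \<phi>(e).\<close>

definition circle_mult :: "nat \<Rightarrow> complex \<Rightarrow> int" where
  "circle_mult j \<zeta> =
     (\<Sum>e\<in>level_moduli j. if \<zeta> ^ ord e q = 1 then int (totient e div ord e q) else 0)"

text \<open>At most one summand is nonzero, since \<alpha> / q^j lies on the unit circle for at most
  one j.\<close>

definition pole_mult :: "complex \<Rightarrow> int" where
  "pole_mult \<alpha> = (\<Sum>j\<le>n. circle_mult j (\<alpha> / of_nat q ^ j))"

text \<open>A finite set carrying \<open>circle_mult j\<close>, used as a range for interchanging
  sums.\<close>

definition level_roots :: "nat \<Rightarrow> complex set" where
  "level_roots j = (\<Union>e\<in>level_moduli j. {\<zeta>. \<zeta> ^ ord e q = 1})"

lemma q_gt_1: "q > 1"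
  unfolding q using p k by (metis one_less_power prime_gt_1_nat not_one_le_zero neq0_conv)

lemma coprime_q_iff: "coprime e q \<longleftrightarrow> coprime e p"
  unfolding q using k by simp

lemma card_level_le: "card {i. i \<le> n \<and> e dvd w i} \<le> Suc n"
  using card_mono[of "{..n}" "{i. i \<le> n \<and> e dvd w i}"] by auto

lemma level_moduli_memD:
  assumes "e \<in> level_moduli j"
  shows "coprime e q" "ord e q > 0" "e > 0" "\<exists>i\<le>n. e dvd w i" "j \<le> n"
proof -
  show "coprime e q"
    using assms coprime_q_iff by (simp add: level_moduli_def)
  then show "ord e q > 0"
    using ord_eq_0 by blast
  show "j \<le> n"
    using assms card_level_le[of e] by (simp add: level_moduli_def)
  have "card {i. i \<le> n \<and> e dvd w i} > 0"
    using assms by (simp add: level_moduli_def)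
  then show *: "\<exists>i\<le>n. e dvd w i"
    unfolding card_gt_0_iff by blast
  then show "e > 0"
    using w by (metis dvd_0_left_iff less_irrefl neq0_conv)
qed

lemma finite_level_moduli [simp]: "finite (level_moduli j)"
proof (rule finite_subset)
  show "level_moduli j \<subseteq> (\<Union>i\<in>{..n}. {e. e dvd w i})"
    by (auto dest: level_moduli_memD(4))
qed (use w in auto)

lemma finite_level_roots [simp]: "finite (level_roots j)"
  unfolding level_roots_def using level_moduli_memD(2)
  by (intro finite_UN_I finite_level_moduli finite_roots_unity) (simp add: Suc_le_eq)

lemma circle_mult_nonneg: "circle_mult j \<zeta> \<ge> 0"
  unfolding circle_mult_def by (intro sum_nonneg) auto

lemma pole_mult_nonneg: "pole_mult \<alpha> \<ge> 0"
  unfolding pole_mult_def by (intro sum_nonneg circle_mult_nonneg)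

lemma circle_mult_nonzero_in_roots:
  assumes "circle_mult j \<zeta> \<noteq> 0"
  shows "\<zeta> \<in> level_roots j"
proof -
  obtain e where "e \<in> level_moduli j"
    "(if \<zeta> ^ ord e q = 1 then int (totient e div ord e q) else 0) \<noteq> 0"
    using assms unfolding circle_mult_def by (rule sum.not_neutral_contains_not_neutral)
  then show ?thesis
    unfolding level_roots_def by (auto split: if_splits)
qed

lemma level_roots_root_of_unity:
  assumes "\<zeta> \<in> level_roots j"
  shows "root_of_unity \<zeta>" "j \<le> n"
  using assms unfolding level_roots_def root_of_unity_def
  by (auto dest: level_moduli_memD(2) level_moduli_memD(5))

lemma norm_root_of_unity:
  assumes "root_of_unity \<zeta>"
  shows "norm \<zeta> = 1"
  using assms unfolding root_of_unity_def by (auto dest: power_eq_1_iff)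

text \<open>After the sums are interchanged, orthogonality leaves \<open>ord e q\<close> or 0, and
  the order cancels against the denominator.\<close>

lemma sum_circle_mult:
  "(\<Sum>\<zeta>\<in>level_roots j. of_int (circle_mult j \<zeta>) * \<zeta> ^ r) =
   (\<Sum>e\<in>level_moduli j. if ord e q dvd r then of_nat (totient e) else (0::complex))"
proof -
  have "(\<Sum>\<zeta>\<in>level_roots j. of_int (circle_mult j \<zeta>) * \<zeta> ^ r) =
      (\<Sum>\<zeta>\<in>level_roots j. \<Sum>e\<in>level_moduli j.
        if \<zeta> ^ ord e q = 1 then of_nat (totient e div ord e q) * \<zeta> ^ r else 0)"
    unfolding circle_mult_def of_int_sum sum_distrib_right by (intro sum.cong) auto
  also have "\<dots> = (\<Sum>e\<in>level_moduli j. \<Sum>\<zeta>\<in>level_roots j.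
        if \<zeta> ^ ord e q = 1 then of_nat (totient e div ord e q) * \<zeta> ^ r else 0)"
    by (rule sum.swap)
  also have "\<dots> = (\<Sum>e\<in>level_moduli j. if ord e q dvd r then of_nat (totient e) else 0)"
  proof (rule sum.cong)
    fix e assume e: "e \<in> level_moduli j"
    have "(\<Sum>\<zeta>\<in>level_roots j. if \<zeta> ^ ord e q = 1 then of_nat (totient e div ord e q) * \<zeta> ^ r else 0) =
        (\<Sum>\<zeta> | \<zeta> ^ ord e q = 1. of_nat (totient e div ord e q) * \<zeta> ^ r :: complex)"
      using e by (intro sum.mono_neutral_cong_right finite_level_roots) (auto simp: level_roots_def)
    also have "\<dots> = of_nat (totient e div ord e q) * (if ord e q dvd r then of_nat (ord e q) else 0)"
      using sum_powers_roots_unity[OF level_moduli_memD(2)[OF e]] by (simp add: sum_distrib_left[symmetric])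
    also have "\<dots> = (if ord e q dvd r then of_nat (totient e) else 0)"
      using order_divides_totient[OF level_moduli_memD(1)[OF e]] by (simp flip: of_nat_mult)
    finally show "(\<Sum>\<zeta>\<in>level_roots j. if \<zeta> ^ ord e q = 1 then of_nat (totient e div ord e q) * \<zeta> ^ r else 0) =
        (if ord e q dvd r then of_nat (totient e) else (0::complex))" .
  qed simp
  finally show ?thesis .
qed

lemma pole_mult_on_circle:
  assumes "norm \<zeta> = 1" "j \<le> n"
  shows "pole_mult (\<zeta> * of_nat q ^ j) = circle_mult j \<zeta>"
proof -
  have "circle_mult i (\<zeta> * of_nat q ^ j / of_nat q ^ i) = 0" if "i \<noteq> j" for i
  proof (rule ccontr)
    assume "circle_mult i (\<zeta> * of_nat q ^ j / of_nat q ^ i) \<noteq> 0"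
    then have "norm (\<zeta> * of_nat q ^ j / of_nat q ^ i) = 1"
      using circle_mult_nonzero_in_roots level_roots_root_of_unity norm_root_of_unity by blast
    then have "real q ^ j = real q ^ i"
      using assms q_gt_1 by (simp add: norm_mult norm_divide norm_power)
    then show False
      using that q_gt_1 by simp
  qed
  then have "pole_mult (\<zeta> * of_nat q ^ j) = (\<Sum>i\<in>{j}. circle_mult i (\<zeta> * of_nat q ^ j / of_nat q ^ i))"
    unfolding pole_mult_def using assms by (intro sum.mono_neutral_right) auto
  then show ?thesis
    using q_gt_1 by simp
qed

lemma pole_mult_nonzeroE:
  assumes "pole_mult \<alpha> \<noteq> 0"
  obtains j \<zeta> where "j \<le> n" "\<zeta> \<in> level_roots j" "\<alpha> = \<zeta> * of_nat q ^ j"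
proof -
  obtain j where "j \<le> n" "circle_mult j (\<alpha> / of_nat q ^ j) \<noteq> 0"
    using assms unfolding pole_mult_def by (metis (lifting) sum.not_neutral_contains_not_neutral atMost_iff)
  then show thesis
    using circle_mult_nonzero_in_roots q_gt_1 by (intro that[of j "\<alpha> / of_nat q ^ j"]) auto
qed

lemma finite_pole_mult: "finite {\<alpha>. pole_mult \<alpha> \<noteq> 0}"
proof (rule finite_subset)
  show "{\<alpha>. pole_mult \<alpha> \<noteq> 0} \<subseteq> (\<Union>j\<in>{..n}. (\<lambda>\<zeta>. \<zeta> * of_nat q ^ j) ` level_roots j)"
    by (auto elim!: pole_mult_nonzeroE)
qed auto

text \<open>The substitution \<alpha> = \<zeta> q^j reduces this to \<open>sum_circle_mult\<close>.
  Exponent 0 is allowed: it yields the spectrum, positive exponents the orbit counts.\<close>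

lemma sum_pole_mult_circle:
  assumes "j \<le> n"
  shows "(\<Sum>\<alpha> | pole_mult \<alpha> \<noteq> 0 \<and> norm \<alpha> = of_nat q ^ j. of_int (pole_mult \<alpha>) * \<alpha> ^ r) =
    (\<Sum>e\<in>level_moduli j. if ord e q dvd r then of_nat (totient e * q ^ (j * r)) else (0::complex))"
proof -
  let ?f = "\<lambda>\<zeta>. \<zeta> * of_nat q ^ j :: complex"
  have norm: "norm \<zeta> = 1" if "\<zeta> \<in> level_roots j" for \<zeta>
    using that level_roots_root_of_unity norm_root_of_unity by blast
  have "(\<Sum>\<alpha> | pole_mult \<alpha> \<noteq> 0 \<and> norm \<alpha> = of_nat q ^ j. of_int (pole_mult \<alpha>) * \<alpha> ^ r) =
      (\<Sum>\<alpha>\<in>?f ` level_roots j. of_int (pole_mult \<alpha>) * \<alpha> ^ r)"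
  proof (rule sum.mono_neutral_left)
    show "{\<alpha>. pole_mult \<alpha> \<noteq> 0 \<and> norm \<alpha> = of_nat q ^ j} \<subseteq> ?f ` level_roots j"
    proof clarify
      fix \<alpha> assume \<alpha>: "pole_mult \<alpha> \<noteq> 0" "norm \<alpha> = of_nat q ^ j"
      then obtain i \<zeta> where i: "i \<le> n" "\<zeta> \<in> level_roots i" "\<alpha> = \<zeta> * of_nat q ^ i"
        by (elim pole_mult_nonzeroE)
      then have "norm \<zeta> = 1"
        using level_roots_root_of_unity norm_root_of_unity by blast
      then have "real q ^ i = real q ^ j"
        using \<alpha> i by (simp add: norm_mult norm_power)
      then show "\<alpha> \<in> ?f ` level_roots j"
        using i q_gt_1 by simp
    qed
    show "\<forall>\<alpha>\<in>?f ` level_roots j - {\<alpha>. pole_mult \<alpha> \<noteq> 0 \<and> norm \<alpha> = of_nat q ^ j}.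
        of_int (pole_mult \<alpha>) * \<alpha> ^ r = 0"
      using norm by (auto simp: norm_mult norm_power)
  qed simp
  also have "\<dots> = (\<Sum>\<zeta>\<in>level_roots j. of_int (pole_mult (?f \<zeta>)) * ?f \<zeta> ^ r)"
    using q_gt_1 by (subst sum.reindex) (auto simp: inj_on_def)
  also have "\<dots> = (\<Sum>\<zeta>\<in>level_roots j. of_nat (q ^ (j * r)) * (of_int (circle_mult j \<zeta>) * \<zeta> ^ r))"
    using norm assms by (intro sum.cong) (simp_all add: pole_mult_on_circle power_mult_distrib power_mult)
  also have "\<dots> = of_nat (q ^ (j * r)) * (\<Sum>e\<in>level_moduli j. if ord e q dvd r then of_nat (totient e) else 0)"
    by (simp only: sum_distrib_left[symmetric] sum_circle_mult)
  also have "\<dots> = (\<Sum>e\<in>level_moduli j. if ord e q dvd r then of_nat (totient e * q ^ (j * r)) else 0)"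
    unfolding sum_distrib_left by (intro sum.cong) auto
  finally show ?thesis .
qed

text \<open>The support is the disjoint union of its parts on the circles of radius q^j, which
  differ because q > 1.\<close>

lemma sum_pole_mult:
  "(\<Sum>\<alpha> | pole_mult \<alpha> \<noteq> 0. of_int (pole_mult \<alpha>) * \<alpha> ^ r) =
   (\<Sum>j\<le>n. \<Sum>e\<in>level_moduli j. if ord e q dvd r then of_nat (totient e * q ^ (j * r)) else (0::complex))"
proof -
  have split: "{\<alpha>. pole_mult \<alpha> \<noteq> 0} = (\<Union>j\<in>{..n}. {\<alpha>. pole_mult \<alpha> \<noteq> 0 \<and> norm \<alpha> = of_nat q ^ j})"
  proof -
    have "\<exists>j\<le>n. norm \<alpha> = of_nat q ^ j" if "pole_mult \<alpha> \<noteq> 0" for \<alpha>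
      using that by (elim pole_mult_nonzeroE)
        (auto simp: norm_mult norm_power norm_root_of_unity[OF level_roots_root_of_unity(1)])
    then show ?thesis by auto
  qed
  have "(\<Sum>\<alpha> | pole_mult \<alpha> \<noteq> 0. of_int (pole_mult \<alpha>) * \<alpha> ^ r) =
      (\<Sum>j\<le>n. \<Sum>\<alpha> | pole_mult \<alpha> \<noteq> 0 \<and> norm \<alpha> = of_nat q ^ j. of_int (pole_mult \<alpha>) * \<alpha> ^ r)"
    unfolding split using finite_pole_mult q_gt_1
    by (intro sum.UNION_disjoint) (auto elim: finite_subset[rotated])
  also have "\<dots> = (\<Sum>j\<le>n. \<Sum>e\<in>level_moduli j. if ord e q dvd r then of_nat (totient e * q ^ (j * r)) else 0)"
    by (rule sum.cong[OF refl], rule sum_pole_mult_circle) simp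
  finally show ?thesis .
qed

lemma twist_count_power_eq:
  assumes "r > 0"
  shows "twist_count n w (q ^ r) =
    (\<Sum>j\<le>n. \<Sum>e\<in>level_moduli j. if ord e q dvd r then totient e * q ^ (j * r) else 0)"
proof -
  let ?c = "\<lambda>e. card {i. i \<le> n \<and> e dvd w i}"
  have dvd_iff: "e dvd q ^ r - 1 \<longleftrightarrow> ord e q dvd r" if "coprime e q" for e
    using q_gt_1 by (simp add: ord_divides[symmetric] cong_altdef_nat)
  \<comment> \<open>With \<open>dvd_iff\<close>, the divisors of q^r - 1 are the e prime to q for
    which \<open>ord e q\<close> divides r.\<close>
  have dvd_coprime: "coprime e q" if "e dvd q ^ r - 1" for e
  proof -
    have "coprime (q ^ r - 1) (q ^ r)"
      using q_gt_1 by (intro coprime_diff_one_left_nat) simp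
    then have "coprime e (q ^ r)"
      by (rule coprime_divisors[OF that dvd_refl])
    then show ?thesis
      using assms by simp
  qed
  have pos: "q ^ r - 1 > 0"
    using one_less_power[OF q_gt_1 assms] by simp
  have "twist_count n w (q ^ r) = (\<Sum>e | e dvd q ^ r - 1. totient e * (\<Sum>j<?c e. (q ^ r) ^ j))"
    using k assms by (intro twist_count_eq[OF p, of "k * r"]) (auto simp: q power_mult)
  \<comment> \<open>Divisors of q^r - 1 that divide no weight have an empty geometric sum; moduli
    not dividing q^r - 1 are switched off by the order condition.\<close>
  also have "\<dots> = (\<Sum>e\<in>level_moduli 0. if ord e q dvd r then totient e * (\<Sum>j<?c e. (q ^ r) ^ j) else 0)"
  proof (rule sum.mono_neutral_cong)
    show "totient e * (\<Sum>j<?c e. (q ^ r) ^ j) = 0" if "e \<in> {e. e dvd q ^ r - 1} - level_moduli 0" for e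
    proof -
      have "coprime e p"
        using that dvd_coprime coprime_q_iff by simp
      then have "\<not> 0 < ?c e"
        using that unfolding level_moduli_def Diff_iff mem_Collect_eq by iprover
      then have "?c e = 0"
        by (simp only: not_gr_zero)
      then show ?thesis
        by (simp only: lessThan_0 sum.empty mult_0_right)
    qed
    show "(if ord e q dvd r then totient e * (\<Sum>j<?c e. (q ^ r) ^ j) else 0) = 0"
      if "e \<in> level_moduli 0 - {e. e dvd q ^ r - 1}" for e
      using that dvd_iff level_moduli_memD(1)[of e 0] by auto
    show "totient e * (\<Sum>j<?c e. (q ^ r) ^ j) =
        (if ord e q dvd r then totient e * (\<Sum>j<?c e. (q ^ r) ^ j) else 0)"
      if "e \<in> {e. e dvd q ^ r - 1} \<inter> level_moduli 0" for e
      using that dvd_iff dvd_coprime[of e] by auto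
  qed (use pos in auto)
  \<comment> \<open>At most n + 1 weights are divisible by e, so j \<le> n is automatic; it gives j
    a range independent of e for swapping the sums.\<close>
  also have "\<dots> = (\<Sum>e\<in>level_moduli 0. \<Sum>j | j \<in> {..n} \<and> j < ?c e.
      if ord e q dvd r then totient e * q ^ (j * r) else 0)"
  proof (rule sum.cong)
    fix e assume "e \<in> level_moduli 0"
    have "{j. j \<in> {..n} \<and> j < ?c e} = {..<?c e}"
      using card_level_le[of e] by auto
    then show "(if ord e q dvd r then totient e * (\<Sum>j<?c e. (q ^ r) ^ j) else 0) =
        (\<Sum>j | j \<in> {..n} \<and> j < ?c e. if ord e q dvd r then totient e * q ^ (j * r) else 0)"
      by (simp add: sum_distrib_left power_mult[symmetric] mult.commute[of r])
  qed simp
  also have "\<dots> = (\<Sum>j\<le>n. \<Sum>e | e \<in> level_moduli 0 \<and> j < ?c e.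
      if ord e q dvd r then totient e * q ^ (j * r) else 0)"
    by (rule sum.swap_restrict) auto
  also have "\<dots> = (\<Sum>j\<le>n. \<Sum>e\<in>level_moduli j. if ord e q dvd r then totient e * q ^ (j * r) else 0)"
    by (intro sum.cong) (auto simp: level_moduli_def)
  finally show ?thesis .
qed

lemma cyclotomic_factorization_pole_mult:
  "cyclotomic_factorization n q (twist_zeta n w q) pole_mult"
  unfolding cyclotomic_factorization_def
proof (intro conjI finite_pole_mult allI impI)
  fix \<alpha> assume "pole_mult \<alpha> \<noteq> 0"
  then show "\<exists>\<zeta> j. root_of_unity \<zeta> \<and> j \<le> n \<and> \<alpha> = \<zeta> * of_nat q ^ j"
    using level_roots_root_of_unity(1) by (elim pole_mult_nonzeroE) blast
next
  show "twist_zeta n w q = (\<Prod>\<alpha> | pole_mult \<alpha> \<noteq> 0. (1 - fps_const \<alpha> * fps_X) powi - pole_mult \<alpha>)"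
    unfolding twist_zeta_eq_product_iff[OF finite_pole_mult] sum_pole_mult
  proof (intro allI impI)
    fix r :: nat assume "r > 0"
    then show "of_nat (twist_count n w (q ^ r)) = (\<Sum>j\<le>n. \<Sum>e\<in>level_moduli j.
        if ord e q dvd r then of_nat (totient e * q ^ (j * r)) else (0::complex))"
      by (simp add: twist_count_power_eq if_distrib[of of_nat] cong: if_cong)
  qed
qed

lemma ex1_cyclotomic_factorization:
  "\<exists>!b. cyclotomic_factorization n q (twist_zeta n w q) b"
  using cyclotomic_factorization_pole_mult cyclotomic_factorization_twist_zeta_unique q_gt_1
  by (metis less_trans zero_less_one)

lemma twist_multiplicity_eq: "twist_multiplicity n w q = pole_mult"
  unfolding twist_multiplicity_def
proof (rule the_equality)
  show "b = pole_mult" if "cyclotomic_factorization n q (twist_zeta n w q) b" for b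
    using that ex1_cyclotomic_factorization cyclotomic_factorization_pole_mult by blast
qed (rule cyclotomic_factorization_pole_mult)

text \<open>Exponent 0 in \<open>sum_pole_mult_circle\<close>: every order divides 0 and the power
  of q is 1, so q disappears.\<close>

lemma multiplicity_spectrum_eq:
  assumes "j \<le> n"
  shows "multiplicity_spectrum n w q j = (\<Sum>e\<in>level_moduli j. int (totient e))"
proof -
  have "(of_int (multiplicity_spectrum n w q j) :: complex) = of_int (\<Sum>e\<in>level_moduli j. int (totient e))"
    using sum_pole_mult_circle[OF assms, of 0]
    by (simp add: multiplicity_spectrum_def twist_multiplicity_eq)
  then show ?thesis
    by (simp only: of_int_eq_iff)
qed

lemma twist_multiplicity_root_of_unity:
  assumes "j \<le> n" "root_of_unity \<zeta>"
  shows "twist_multiplicity n w q (\<zeta> * of_nat q ^ j) =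
    (\<Sum>e | coprime e p \<and> j < card {i. i \<le> n \<and> e dvd w i}.
      if \<zeta> ^ ord e q = 1 then int (totient e div ord e q) else 0)"
  using pole_mult_on_circle[OF norm_root_of_unity[OF assms(2)] assms(1)]
  by (simp only: twist_multiplicity_eq circle_mult_def level_moduli_def)

end

section \<open>Failure of palindromy and of the functional equation\<close>

locale nontrivial_weighted_projective_stack = weighted_projective_stack +
  assumes gcd: "Gcd (w ` {..n}) = 1" and ex: "\<exists>e\<ge>2. coprime e p \<and> (\<exists>i\<le>n. e dvd w i)"
begin

text \<open>A modulus of level n divides all n + 1 weights, hence their gcd.\<close>

lemma level_moduli_top: "level_moduli n = {1}"
proof (intro equalityI subsetI)
  fix e assume e: "e \<in> level_moduli n"
  have "{i. i \<le> n \<and> e dvd w i} = {..n}"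
    using e by (intro card_subset_eq) (auto simp: level_moduli_def intro: le_antisym card_level_le)
  then have "e dvd Gcd (w ` {..n})"
    by (intro Gcd_greatest) auto
  then show "e \<in> {1}"
    using gcd by simp
qed (simp add: level_moduli_def)

lemma level_moduli_bottom:
  obtains e where "e \<ge> 2" "{1, e} \<subseteq> level_moduli 0"
proof -
  obtain e i where e: "e \<ge> 2" "coprime e p" "i \<le> n" "e dvd w i"
    using ex by blast
  then have "card {i. i \<le> n \<and> e dvd w i} > 0" 
    by (auto simp: card_gt_0_iff)
  with e show thesis
    by (intro that[of e]) (auto simp: level_moduli_def)
qed

lemma spectrum_top: "multiplicity_spectrum n w q n = 1"
  by (simp add: multiplicity_spectrum_eq level_moduli_top)

lemma spectrum_bottom: "multiplicity_spectrum n w q 0 \<ge> 2"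
proof -
  obtain e where e: "e \<ge> 2" "{1, e} \<subseteq> level_moduli 0"
    by (rule level_moduli_bottom)
  have "2 \<le> (\<Sum>e\<in>{1, e}. int (totient e))"
    using e by (simp add: totient_gt_0_iff Suc_le_eq)
  also have "\<dots> \<le> (\<Sum>e\<in>level_moduli 0. int (totient e))"
    using e by (intro sum_mono2) auto
  finally show ?thesis
    by (simp add: multiplicity_spectrum_eq)
qed

lemma not_palindromic: "\<not> palindromic n (multiplicity_spectrum n w q)"
  using spectrum_top spectrum_bottom by (auto simp: palindromic_def dest!: spec[of _ 0])

lemma pole_mult_top: "pole_mult (of_nat q ^ n) = 1"
  using pole_mult_on_circle[of 1 n] by (simp add: circle_mult_def level_moduli_top)

text \<open>At \<zeta> = 1 every modulus of level 0 contributes \<phi>(e)/o_e, a positive integer,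
  and there are at least two moduli.\<close>

lemma pole_mult_one: "pole_mult 1 \<ge> 2"
proof -
  obtain e where e: "e \<ge> 2" "{1, e} \<subseteq> level_moduli 0"
    by (rule level_moduli_bottom)
  have "totient e div ord e q > 0"
    using e order_divides_totient[of e q] level_moduli_memD[of e 0]
    by (auto simp: div_greater_zero_iff totient_gt_0_iff intro!: dvd_imp_le)
  then have "2 \<le> (\<Sum>e\<in>{1, e}. int (totient e div ord e q))"
    using e by (simp add: Suc_le_eq)
  also have "\<dots> \<le> (\<Sum>e\<in>level_moduli 0. int (totient e div ord e q))"
    using e by (intro sum_mono2) auto
  finally show ?thesis
    using pole_mult_on_circle[of 1 0] by (simp add: circle_mult_def)
qed

lemma no_functional_equation: "\<not> global_functional_equation n q (twist_zeta n w q)"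
proof -
  let ?S = "{\<alpha>. pole_mult \<alpha> \<noteq> 0}"
  let ?N = "of_nat q ^ n :: complex"
  \<comment> \<open>All multiplicities are nonnegative, so the zeta function is the reciprocal of
    this polynomial.\<close>
  define D where "D = (\<Prod>\<alpha>\<in>?S. [:1, - \<alpha>:] ^ nat (pole_mult \<alpha>))"
  define E where "E = [:1, -1:] ^ (nat (pole_mult 1) - 2) *
    (\<Prod>\<alpha>\<in>?S - {1}. [:1, - \<alpha>:] ^ nat (pole_mult \<alpha>))"
  define H where "H = (\<Prod>\<alpha>\<in>?S - {?N}. [:1, - \<alpha>:] ^ nat (pole_mult \<alpha>))"
  have "D = [:1, -1:] ^ nat (pole_mult 1) * (\<Prod>\<alpha>\<in>?S - {1}. [:1, - \<alpha>:] ^ nat (pole_mult \<alpha>))"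
    unfolding D_def using finite_pole_mult pole_mult_one by (subst prod.remove[of _ 1]) auto
  also have "nat (pole_mult 1) = 2 + (nat (pole_mult 1) - 2)"
    using pole_mult_one by linarith
  finally have DE: "D = [:1, -1:]\<^sup>2 * E"
    unfolding power_add E_def by (simp only: mult.assoc add_diff_cancel_left')
  have DH: "D = [:1, - ?N:] * H"
    unfolding D_def H_def using finite_pole_mult pole_mult_top
    by (subst prod.remove[of _ ?N]) auto
  \<comment> \<open>A factor 1 - \<alpha>t vanishes at q^(-n) only for \<alpha> = q^n, which has
    been removed.\<close>
  have H: "poly H (1 / ?N) \<noteq> 0"
    unfolding H_def using finite_pole_mult q_gt_1 by (auto simp: poly_prod poly_power)
  have "twist_zeta n w q = (\<Prod>\<alpha>\<in>?S. (1 - fps_const \<alpha> * fps_X) powi (- pole_mult \<alpha>))"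
    using cyclotomic_factorization_pole_mult by (simp add: cyclotomic_factorization_def)
  moreover have "fps_of_poly D = (\<Prod>\<alpha>\<in>?S. (1 - fps_const \<alpha> * fps_X) ^ nat (pole_mult \<alpha>))"
    unfolding D_def fps_of_poly_prod fps_of_poly_power
    by (intro prod.cong) (simp_all add: fps_of_poly_pCons fps_of_poly_const mult.commute)
  ultimately have "twist_zeta n w q * fps_of_poly D = (\<Prod>\<alpha>\<in>?S.
      (1 - fps_const \<alpha> * fps_X) powi (- pole_mult \<alpha>) * (1 - fps_const \<alpha> * fps_X) ^ nat (pole_mult \<alpha>))"
    by (simp only: prod.distrib)
  also have "\<dots> = 1"
  proof (rule prod.neutral, rule ballI)
    fix \<alpha> assume "\<alpha> \<in> ?S"
    then have "pole_mult \<alpha> > 0"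
      using pole_mult_nonneg[of \<alpha>] by auto
    moreover have "inverse (1 - fps_const \<alpha> * fps_X) * (1 - fps_const \<alpha> * fps_X) = 1"
      by (intro inverse_mult_eq_1) simp
    ultimately show "(1 - fps_const \<alpha> * fps_X) powi (- pole_mult \<alpha>) *
        (1 - fps_const \<alpha> * fps_X) ^ nat (pole_mult \<alpha>) = 1"
      by (simp add: power_int_def power_mult_distrib[symmetric])
  qed
  finally show ?thesis
    using q_gt_1 DE DH H by (intro no_global_functional_equation) auto
qed

end

text \<open>Unique existence of b justifies the description in \<open>twist_multiplicity\<close>.
  The final formula makes the redistribution precise: q enters its right side only through
  \<open>ord e q\<close>, which governs the position on the circle, while the index set depends on
  j.\<close>

theorem corollary7p7:
  fixes p n :: nat and w :: "nat \<Rightarrow> nat"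
  assumes "prime p"
    and "\<forall>i\<le>n. w i > 0"
    and "Gcd (w ` {..n}) = 1"
    and "\<exists>e\<ge>2. coprime e p \<and> (\<exists>i\<le>n. e dvd w i)"
  shows "\<forall>q \<in> {p ^ k | k. k \<ge> 1}.
      (\<exists>!b. cyclotomic_factorization n q (twist_zeta n w q) b) \<and>
      \<not> global_functional_equation n q (twist_zeta n w q) \<and>
      (\<forall>q' \<in> {p ^ k | k. k \<ge> 1}. \<forall>j\<le>n.
         multiplicity_spectrum n w q j = multiplicity_spectrum n w q' j) \<and>
      \<not> palindromic n (multiplicity_spectrum n w q) \<and>
      (\<forall>j\<le>n. \<forall>\<zeta>. root_of_unity \<zeta> \<longrightarrow>
         twist_multiplicity n w q (\<zeta> * of_nat q ^ j) =
         (\<Sum>e | coprime e p \<and> j < card {i. i \<le> n \<and> e dvd w i}.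
            if \<zeta> ^ ord e q = 1 then int (totient e div ord e q) else 0))"
proof
  fix q assume "q \<in> {p ^ k | k. k \<ge> 1}"
  then obtain k where k: "k \<ge> 1" "q = p ^ k"
    by blast
  interpret nontrivial_weighted_projective_stack p n k q w
    using assms k by unfold_locales auto
  have spectrum: "multiplicity_spectrum n w q j = multiplicity_spectrum n w q' j"
    if q': "q' \<in> {p ^ k | k. k \<ge> 1}" and j: "j \<le> n" for q' j
  proof -
    obtain k' where k': "k' \<ge> 1" "q' = p ^ k'"
      using q' by blast
    \<comment> \<open>This instance shares p, n and w, and \<open>level_moduli\<close> does not
      involve q, so both spectra are the same sum.\<close>
    interpret q': weighted_projective_stack p n k' q' w
      using assms k' by unfold_locales auto
    show ?thesis
      by (simp only: multiplicity_spectrum_eq[OF j] q'.multiplicity_spectrum_eq[OF j])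
  qed
  show "(\<exists>!b. cyclotomic_factorization n q (twist_zeta n w q) b) \<and>
      \<not> global_functional_equation n q (twist_zeta n w q) \<and>
      (\<forall>q' \<in> {p ^ k | k. k \<ge> 1}. \<forall>j\<le>n.
         multiplicity_spectrum n w q j = multiplicity_spectrum n w q' j) \<and>
      \<not> palindromic n (multiplicity_spectrum n w q) \<and>
      (\<forall>j\<le>n. \<forall>\<zeta>. root_of_unity \<zeta> \<longrightarrow>
         twist_multiplicity n w q (\<zeta> * of_nat q ^ j) =
         (\<Sum>e | coprime e p \<and> j < card {i. i \<le> n \<and> e dvd w i}.
            if \<zeta> ^ ord e q = 1 then int (totient e div ord e q) else 0))"
    by (intro conjI ballI allI impI ex1_cyclotomic_factorization no_functional_equation
        spectrum not_palindromic twist_multiplicity_root_of_unity)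
qed

end
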